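(* Let $k,n$ be positive integers with $k\le n/200$. Any non-adaptive distribution-free testing algorithm for $k$-juntas over $\{0,1\}^n$ with distance parameter $\epsilon=1/3$ must have query complexity $\Omega(2^{k/3})$.
   Context: A Boolean function $f:\{0,1\}^n\to\{0,1\}$ is a $k$-junta if it depends on at most $k$ of its variables. For a distribution $\mathcal{D}$ on $\{0,1\}^n$, $f$ is $\epsilon$-far from $k$-juntas with respect to $\mathcal{D}$ if $\Pr_{x\sim\mathcal{D}}[f(x)\ne g(x)]\ge\epsilon$ for every $k$-junta $g$. In the distribution-free testing model the (randomized) algorithm has oracle access to an unknown pair $(f,\mathcal{D})$: black-box queries return $f(x)$ for any chosen $x$, and sample requests return $(x,f(x))$ with $x\sim\mathcal{D}$ independent. It must accept with probability at least $2/3$ when $f$ is a $k$-junta and reject with probability at least $2/3$ when $f$ is $\epsilon$-far from $k$-juntas with respect to $\mathcal{D}$. Query complexity is the worst-case number of black-box queries plus samples. A non-adaptive algorithm first draws all its samples, then chooses all its black-box queries in a single batch: the queries may depend on the samples (and their labels) but not on answers to other black-box queries. *)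

theory Defs
  imports "HOL-Probability.Probability"
begin

text \<open>
  Points of \<open>{0,1}\<^sup>n\<close> are the Boolean lists of length \<open>n\<close>. A Boolean function
  over the cube is a function on all Boolean lists of which only the values on
  \<open>cube n\<close> are ever used.
\<close>

definition cube :: "nat \<Rightarrow> bool list set" where
  "cube n = {x. length x = n}"

definition depends_on :: "nat \<Rightarrow> (bool list \<Rightarrow> bool) \<Rightarrow> nat \<Rightarrow> bool" where
  "depends_on n f i \<longleftrightarrow> (\<exists>x\<in>cube n. f (x[i := \<not> x ! i]) \<noteq> f x)"

definition junta :: "nat \<Rightarrow> nat \<Rightarrow> (bool list \<Rightarrow> bool) \<Rightarrow> bool" where
  "junta n k f \<longleftrightarrow> card {i. i < n \<and> depends_on n f i} \<le> k"

definition far_from_juntas ::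
    "nat \<Rightarrow> nat \<Rightarrow> real \<Rightarrow> bool list pmf \<Rightarrow> (bool list \<Rightarrow> bool) \<Rightarrow> bool" where
  "far_from_juntas n k \<epsilon> D f \<longleftrightarrow>
     (\<forall>g. junta n k g \<longrightarrow> measure_pmf.prob D {x. f x \<noteq> g x} \<ge> \<epsilon>)"

text \<open>
  A deterministic non-adaptive algorithm. \<open>Sample a\<close> requests a labelled sample
  \<open>(x, f x)\<close> and continues with \<open>a (x, f x)\<close>, so each step may use all samples
  and labels seen so far, including for the decision to stop sampling.
  \<open>Query Q d\<close> ends the sampling phase: it asks for \<open>f\<close> at all points of \<open>Q\<close> in
  one batch and accepts iff \<open>d\<close> holds of the list of answers.
\<close>

datatype algorithm =
    Sample "bool list \<times> bool \<Rightarrow> algorithm"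
  | Query "bool list list" "bool list \<Rightarrow> bool"

primrec queries_in_cube :: "nat \<Rightarrow> algorithm \<Rightarrow> bool" where
  "queries_in_cube n (Sample a) \<longleftrightarrow> (\<forall>x\<in>cube n. \<forall>b. queries_in_cube n (a (x, b)))"
| "queries_in_cube n (Query Q d) \<longleftrightarrow> set Q \<subseteq> cube n"

text \<open>The verdict of an algorithm with access to \<open>(f, D)\<close>, where \<open>True\<close> means accept.\<close>

primrec verdict :: "(bool list \<Rightarrow> bool) \<Rightarrow> bool list pmf \<Rightarrow> algorithm \<Rightarrow> bool pmf" where
  "verdict f D (Sample a) = bind_pmf D (\<lambda>x. verdict f D (a (x, f x)))"
| "verdict f D (Query Q d) = return_pmf (d (map f Q))"

text \<open>
  The number of samples plus black-box queries on input \<open>f\<close>, in the worst case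
  over the outcomes of the samples.
\<close>

primrec cost :: "nat \<Rightarrow> (bool list \<Rightarrow> bool) \<Rightarrow> algorithm \<Rightarrow> nat" where
  "cost n f (Sample a) = Suc (MAX x\<in>cube n. cost n f (a (x, f x)))"
| "cost n f (Query Q d) = length Q"

lemma finite_cube: "finite (cube n)"
  unfolding cube_def using finite_lists_length_eq[of "UNIV :: bool set" n] by simp

lemma cube_nonempty: "cube n \<noteq> {}"
proof -
  have "replicate n True \<in> cube n"
    by (simp add: cube_def)
  then show ?thesis
    by auto
qed

text \<open>
  A randomized algorithm is a probability distribution over deterministic ones.
  Discrete distributions lose no generality: among the algorithms of bounded cost
  over \<open>{0,1}\<^sup>n\<close> only finitely many behaviours are distinguishable.
\<close>

definition randomized_verdict ::
    "algorithm pmf \<Rightarrow> (bool list \<Rightarrow> bool) \<Rightarrow> bool list pmf \<Rightarrow> bool pmf" where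
  "randomized_verdict T f D = bind_pmf T (verdict f D)"

definition query_complexity :: "nat \<Rightarrow> algorithm pmf \<Rightarrow> enat" where
  "query_complexity n T = (SUP A\<in>set_pmf T. SUP f. enat (cost n f A))"

definition nonadaptive_junta_tester :: "nat \<Rightarrow> nat \<Rightarrow> real \<Rightarrow> algorithm pmf \<Rightarrow> bool" where
  "nonadaptive_junta_tester n k \<epsilon> T \<longleftrightarrow>
     (\<forall>A\<in>set_pmf T. queries_in_cube n A) \<and>
     (\<forall>f D. set_pmf D \<subseteq> cube n \<longrightarrow>
        (junta n k f \<longrightarrow> pmf (randomized_verdict T f D) True \<ge> 2 / 3) \<and>
        (far_from_juntas n k \<epsilon> D f \<longrightarrow> pmf (randomized_verdict T f D) False \<ge> 2 / 3))"

end

(*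
The yes-instances are random k-juntas h(x_J), with the distribution uniform on a random set S of
m = 39 n 2^k points of the cube. The no-instances give the points of S independent random labels;
a point x gets the label of the nearest point of S that lies within distance 2n/5 of x and has the
same projection to J as x, and the label h(x_J) if there is none. Since m is much larger than the
logarithm of the number of k-juntas, random labels are far from all of them.

The two kinds of instances look alike as long as no query is close to an undrawn point of S, no
drawn point is close to another point of S, and no two drawn points, nor a query and a drawn point,
are far apart with equal projections. The first two conditions are likely to hold because Hamming
balls of radius 2n/5 are tiny compared to the cube; the last one fails for a given pair with
probability at most (3/5)^k, which is less than the inverse of (2^(k/3))^2.
*)

theory Submission
  imports Defs
begin

section \<open>Discrete distributions\<close>

lemma integrable_pmf_pmf [simp]: "integrable (measure_pmf p) (\<lambda>x. pmf (f x) a)"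
  by (intro measure_pmf.integrable_const_bound[where B = 1]) (auto simp: pmf_le_1)

lemma prob_pair_pmf_le_fst:
  assumes "\<And>x. x \<in> set_pmf p \<Longrightarrow> measure_pmf.prob q {y. P x y} \<le> b"
  shows "measure_pmf.prob (pair_pmf p q) {(x, y). P x y} \<le> b"
proof -
  have "measure_pmf.prob (pair_pmf p q) {(x, y). P x y} =
      measure_pmf.expectation p (\<lambda>x. measure_pmf.prob q {y. P x y})"
  proof -
    have "measure_pmf.prob (pair_pmf p q) {(x, y). P x y} =
        pmf (bind_pmf p (\<lambda>x. map_pmf (\<lambda>y. P x y) q)) True"
    proof -
      have "bind_pmf p (\<lambda>x. map_pmf (\<lambda>y. P x y) q) = map_pmf (\<lambda>(x, y). P x y) (pair_pmf p q)"
        by (simp add: pair_pmf_def map_bind_pmf) (simp add: map_pmf_def)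
      then show ?thesis
        by (simp add: pmf_map vimage_def)
    qed
    then show ?thesis
      by (simp add: pmf_bind pmf_map vimage_def)
  qed
  also have "\<dots> \<le> measure_pmf.expectation p (\<lambda>_. b)"
  proof (rule integral_mono_AE)
    show "integrable (measure_pmf p) (\<lambda>x. measure_pmf.prob q {y. P x y})"
      by (intro measure_pmf.integrable_const_bound[where B = 1]) auto
  qed (use assms in \<open>auto simp: AE_measure_pmf_iff\<close>)
  finally show ?thesis
    by simp
qed

lemma prob_pair_pmf_le_snd:
  assumes "\<And>y. y \<in> set_pmf q \<Longrightarrow> measure_pmf.prob p {x. P x y} \<le> b"
  shows "measure_pmf.prob (pair_pmf p q) {(x, y). P x y} \<le> b"
proof -
  have "measure_pmf.prob (pair_pmf p q) {(x, y). P x y} =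
      measure_pmf.prob (pair_pmf q p) {(y, x). P x y}"
    by (subst pair_commute_pmf) (simp add: vimage_def split_def)
  also have "\<dots> \<le> b"
    by (rule prob_pair_pmf_le_fst) (use assms in auto)
  finally show ?thesis .
qed

lemma pmf_bind_mono:
  fixes f g :: "'a \<Rightarrow> 'b pmf"
  assumes "\<And>x. x \<in> set_pmf p \<Longrightarrow> pmf (f x) a \<le> pmf (g x) a + b"
  shows "pmf (bind_pmf p f) a \<le> pmf (bind_pmf p g) a + b"
proof -
  have "pmf (bind_pmf p f) a \<le> measure_pmf.expectation p (\<lambda>x. pmf (g x) a + b)"
    unfolding pmf_bind using assms
    by (intro integral_mono_AE Bochner_Integration.integrable_add) (auto simp: AE_measure_pmf_iff)
  also have "\<dots> = pmf (bind_pmf p g) a + b"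
    by (simp add: pmf_bind)
  finally show ?thesis .
qed

lemma pmf_bind_le_bad:
  fixes p :: "'a pmf"
  assumes "\<And>x. x \<in> set_pmf p \<Longrightarrow> x \<notin> B \<Longrightarrow> pmf (f x) a \<le> c" "c \<ge> 0"
  shows "pmf (bind_pmf p f) a \<le> c + measure_pmf.prob p B"
proof -
  have int: "integrable (measure_pmf p) (indicator B :: 'a \<Rightarrow> real)"
    by (intro measure_pmf.integrable_const_bound[where B = 1]) auto
  have "pmf (bind_pmf p f) a \<le> measure_pmf.expectation p (\<lambda>x. c + indicator B x)"
    unfolding pmf_bind
  proof (rule integral_mono_AE)
    show "AE x in measure_pmf p. pmf (f x) a \<le> c + indicator B x"
      using assms by (auto simp: AE_measure_pmf_iff indicator_def intro!: add_increasing pmf_le_1)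
    show "integrable (measure_pmf p) (\<lambda>x. c + indicator B x)"
      by (intro Bochner_Integration.integrable_add int) auto
  qed simp
  also have "\<dots> = c + measure_pmf.prob p B"
    by (simp add: int)
  finally show ?thesis .
qed

lemma pmf_bind_ge:
  assumes "\<And>x. x \<in> set_pmf p \<Longrightarrow> pmf (f x) a \<ge> c"
  shows "pmf (bind_pmf p f) a \<ge> c"
proof -
  have "measure_pmf.expectation p (\<lambda>_. c) \<le> pmf (bind_pmf p f) a"
    unfolding pmf_bind using assms by (intro integral_mono_AE) (auto simp: AE_measure_pmf_iff)
  then show ?thesis
    by simp
qed

lemma prob_mono_pmf:
  assumes "\<And>x. x \<in> set_pmf p \<Longrightarrow> P x \<Longrightarrow> Q x"
  shows "measure_pmf.prob p {x. P x} \<le> measure_pmf.prob p {x. Q x}"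
  using assms by (intro measure_pmf.finite_measure_mono_AE) (auto simp: AE_measure_pmf_iff)

lemma prob_union_bound:
  assumes "finite I" "\<And>i. i \<in> I \<Longrightarrow> measure_pmf.prob p {x. P i x} \<le> b"
  shows "measure_pmf.prob p {x. \<exists>i\<in>I. P i x} \<le> real (card I) * b"
proof -
  have "measure_pmf.prob p {x. \<exists>i\<in>I. P i x} = measure_pmf.prob p (\<Union>i\<in>I. {x. P i x})"
    by (rule arg_cong[where f = "measure_pmf.prob p"]) auto
  also have "\<dots> \<le> (\<Sum>i\<in>I. measure_pmf.prob p {x. P i x})"
    by (rule measure_pmf.finite_measure_subadditive_finite) (use assms in auto)
  also have "\<dots> \<le> (\<Sum>i\<in>I. b)"
    by (intro sum_mono assms)
  finally show ?thesis
    by simp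
qed

lemma prob_disj_le:
  "measure_pmf.prob p {x. P x \<or> Q x} \<le> measure_pmf.prob p {x. P x} + measure_pmf.prob p {x. Q x}"
proof -
  have "{x. P x \<or> Q x} = {x. P x} \<union> {x. Q x}"
    by auto
  then show ?thesis
    using measure_subadditive[of "{x. P x}" "measure_pmf p" "{x. Q x}"] by simp
qed

lemma markov_pmf:
  fixes g :: "'a \<Rightarrow> real"
  assumes "finite (set_pmf p)" "\<And>x. x \<in> set_pmf p \<Longrightarrow> g x \<ge> 0"
    "\<And>x. x \<in> set_pmf p \<Longrightarrow> P x \<Longrightarrow> 1 \<le> g x"
  shows "measure_pmf.prob p {x. P x} \<le> measure_pmf.expectation p g"
proof -
  have "measure_pmf.prob p {x. P x} = measure_pmf.expectation p (indicator {x. P x})"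
    by simp
  also have "\<dots> \<le> measure_pmf.expectation p g"
    using assms(2,3)
    by (intro integral_mono_AE integrable_measure_pmf_finite assms)
      (auto simp: AE_measure_pmf_iff indicator_def)
  finally show ?thesis .
qed

lemma pair_pmf_of_set:
  assumes "finite A" "A \<noteq> {}" "finite B" "B \<noteq> {}"
  shows "pair_pmf (pmf_of_set A) (pmf_of_set B) = pmf_of_set (A \<times> B)"
proof (rule pmf_eqI)
  fix z
  show "pmf (pair_pmf (pmf_of_set A) (pmf_of_set B)) z = pmf (pmf_of_set (A \<times> B)) z"
    using assms by (cases z) (simp add: pmf_pair pmf_of_set indicator_def card_cartesian_product)
qed

lemma replicate_pmf_map: "replicate_pmf r (map_pmf f p) = map_pmf (map f) (replicate_pmf r p)"
  by (induction r) (simp_all add: map_bind_pmf bind_map_pmf)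

text \<open>Deferred decision: entry \<open>j\<close> of an i.i.d. list may be drawn last, after
  everything that depends only on the other entries.\<close>

lemma replicate_pmf_resample:
  "j < r \<Longrightarrow>
    replicate_pmf r p = bind_pmf (replicate_pmf r p) (\<lambda>S. map_pmf (\<lambda>y. S[j := y]) p)"
proof (induction r arbitrary: j)
  case (Suc r)
  show ?case
  proof (cases j)
    case 0
    have "replicate_pmf (Suc r) p = bind_pmf (replicate_pmf r p) (\<lambda>S. map_pmf (\<lambda>y. y # S) p)"
      by (simp add: map_pmf_def bind_commute_pmf[of p])
    also have "\<dots> = bind_pmf (replicate_pmf (Suc r) p) (\<lambda>S. map_pmf (\<lambda>y. S[0 := y]) p)"
    proof -
      have "list_update (x # S) 0 = (\<lambda>y. y # S)" for x :: 'a and S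
        by auto
      then show ?thesis
        by (simp add: bind_assoc_pmf bind_return_pmf)
    qed
    finally show ?thesis
      by (simp add: 0)
  next
    case (Suc i)
    then have i: "i < r"
      using Suc.prems by simp
    have "replicate_pmf (Suc r) p = bind_pmf p (\<lambda>x. map_pmf ((#) x) (replicate_pmf r p))"
      by (simp add: map_pmf_def)
    also have "\<dots> = bind_pmf p (\<lambda>x. map_pmf ((#) x)
        (bind_pmf (replicate_pmf r p) (\<lambda>S. map_pmf (\<lambda>y. S[i := y]) p)))"
      using Suc.IH[OF i] by simp
    also have "\<dots> = bind_pmf (replicate_pmf (Suc r) p) (\<lambda>S. map_pmf (\<lambda>y. S[Suc i := y]) p)"
    proof -
      have "list_update (x # S) (Suc i) = (\<lambda>y. x # S[i := y])" for x :: 'a and S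
        by auto
      then show ?thesis
        by (simp add: map_bind_pmf map_pmf_comp bind_assoc_pmf bind_return_pmf)
    qed
    finally show ?thesis
      by (simp only: Suc)
  qed
qed simp

text \<open>Since \<open>g S\<close> ignores entry \<open>j\<close>, redrawing that entry turns
  \<open>S ! j\<close> into a fresh draw independent of \<open>g S\<close>. A bound for every fixed
  \<open>g S\<close> therefore carries over.\<close>

lemma prob_replicate_pmf_entry:
  assumes "j < r" "\<And>S y. length S = r \<Longrightarrow> g (S[j := y]) = g S"
    "\<And>S. S \<in> set_pmf (replicate_pmf r p) \<Longrightarrow> measure_pmf.prob p {y. R (g S) y} \<le> b"
  shows "measure_pmf.prob (replicate_pmf r p) {S. R (g S) (S ! j)} \<le> b"
proof -
  have "measure_pmf.prob (replicate_pmf r p) {S. R (g S) (S ! j)} =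
      pmf (map_pmf (\<lambda>S. R (g S) (S ! j)) (replicate_pmf r p)) True"
    by (simp add: pmf_map vimage_def)
  also have "\<dots> = pmf (bind_pmf (replicate_pmf r p) (\<lambda>S. map_pmf (\<lambda>y. R (g S) y) p)) True"
    by (subst replicate_pmf_resample[OF assms(1)], simp only: map_bind_pmf map_pmf_comp)
      (intro arg_cong2[where f = pmf] bind_pmf_cong map_pmf_cong refl,
        use assms(1,2) in \<open>auto simp: set_replicate_pmf\<close>)
  also have "\<dots> \<le> b"
    using pmf_bind_le_bad[of "replicate_pmf r p" "{}" "\<lambda>S. map_pmf (\<lambda>y. R (g S) y) p" True b]
      assms(3) order_trans[OF measure_nonneg assms(3)] set_pmf_not_empty[of "replicate_pmf r p"]
    by (auto simp: pmf_map vimage_def)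
  finally show ?thesis .
qed

lemma prob_pair_pmf_Times:
  "measure_pmf.prob (pair_pmf p q) (A \<times> B) = measure_pmf.prob p A * measure_pmf.prob q B"
proof -
  have "measure_pmf.prob (pair_pmf p q) (A \<times> B) =
      measure_pmf.prob (pair_pmf p q) ((A \<inter> set_pmf p) \<times> (B \<inter> set_pmf q))"
    by (intro measure_pmf.finite_measure_eq_AE) (auto simp: AE_measure_pmf_iff)
  also have "\<dots> = measure_pmf.prob p A * measure_pmf.prob q B"
    by (subst measure_pmf_prob_product) (auto simp: measure_Int_set_pmf)
  finally show ?thesis .
qed

lemma prob_replicate_pmf_set_subset:
  "measure_pmf.prob (replicate_pmf r p) {xs. set xs \<subseteq> A} = measure_pmf.prob p A ^ r"
proof (induction r)
  case (Suc r)
  have "replicate_pmf (Suc r) p = map_pmf (\<lambda>(x, xs). x # xs) (pair_pmf p (replicate_pmf r p))"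
    by (simp add: pair_pmf_def map_bind_pmf)
  then have "measure_pmf.prob (replicate_pmf (Suc r) p) {xs. set xs \<subseteq> A} =
      measure_pmf.prob (pair_pmf p (replicate_pmf r p)) (A \<times> {xs. set xs \<subseteq> A})"
    by (auto simp: vimage_def split_def intro!: arg_cong[where f = "measure_pmf.prob _"])
  also have "\<dots> = measure_pmf.prob p A * measure_pmf.prob (replicate_pmf r p) {xs. set xs \<subseteq> A}"
    by (rule prob_pair_pmf_Times)
  finally show ?case
    using Suc by simp
qed simp

section \<open>Coin flips and the uniform distribution on the cube\<close>

abbreviation coin :: "bool pmf" where
  "coin \<equiv> pmf_of_set UNIV"

lemma card_cube: "card (cube n) = 2 ^ n"
  using card_lists_length_eq[of "UNIV :: bool set" n] by (simp add: cube_def)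

text \<open>Links two views of a random bit string: independent entries, which can be redrawn one at
  a time, and a uniform element of a finite set, which suits counting and bijections.\<close>

lemma replicate_coin: "replicate_pmf n coin = pmf_of_set (cube n)"
proof (rule pmf_eqI)
  fix xs :: "bool list"
  have "pmf (replicate_pmf n coin) xs = (if length xs = n then (1 / 2) ^ n else 0)"
  proof (induction n arbitrary: xs)
    case (Suc n)
    have "replicate_pmf (Suc n) coin = map_pmf (\<lambda>(x, xs). x # xs) (pair_pmf coin (replicate_pmf n coin))"
      by (simp add: pair_pmf_def map_bind_pmf)
    moreover have "inj (\<lambda>(x :: bool, xs). x # xs)"
      by (auto simp: inj_def)
    ultimately have "pmf (replicate_pmf (Suc n) coin) (y # ys) = pmf (pair_pmf coin (replicate_pmf n coin)) (y, ys)"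
      for y ys
      using pmf_map_inj'[of "\<lambda>(x, xs). x # xs" "pair_pmf coin (replicate_pmf n coin)" "(y, ys)"]
      by simp
    moreover have "pmf (replicate_pmf (Suc n) coin) [] = 0"
      by (auto simp: pmf_eq_0_set_pmf set_replicate_pmf)
    ultimately show ?case
      by (cases xs) (simp_all only: pmf_pair Suc, auto)
  qed (auto simp: indicator_def)
  then show "pmf (replicate_pmf n coin) xs = pmf (pmf_of_set (cube n)) xs"
    by (simp add: finite_cube cube_nonempty card_cube) (simp add: cube_def indicator_def power_one_over)
qed


section \<open>Hamming distance\<close>

definition hdist :: "bool list \<Rightarrow> bool list \<Rightarrow> nat" where
  "hdist x y = card {i. i < length x \<and> x ! i \<noteq> y ! i}"

lemma hdist_Cons: "hdist (a # x) (b # y) = (if a = b then 0 else 1) + hdist x y"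
proof -
  have "{i. i < length (a # x) \<and> (a # x) ! i \<noteq> (b # y) ! i} =
      (if a = b then {} else {0}) \<union> Suc ` {i. i < length x \<and> x ! i \<noteq> y ! i}"
    by (auto simp: image_iff less_Suc_eq_0_disj)
  moreover have "card (Suc ` {i. i < length x \<and> x ! i \<noteq> y ! i}) = hdist x y"
    by (simp add: card_image hdist_def)
  ultimately show ?thesis
    by (auto simp: hdist_def card_insert_if)
qed

lemma hdist_self [simp]: "hdist x x = 0"
  by (simp add: hdist_def)

lemma hdist_eq_0_iff: "length x = length y \<Longrightarrow> hdist x y = 0 \<longleftrightarrow> x = y"
  by (auto simp: hdist_def list_eq_iff_nth_eq)

lemma set_replicate_coin: "set_pmf (replicate_pmf n coin) = cube n"
  by (simp add: replicate_coin finite_cube cube_nonempty)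

text \<open>The moment generating function of a binomial variable: each coordinate independently
  contributes a factor 1 or \<open>t\<close>, with mean \<open>(1 + t) / 2\<close>.\<close>

lemma expectation_power_hdist:
  fixes t :: real
  assumes "length x = n"
  shows "measure_pmf.expectation (replicate_pmf n coin) (\<lambda>y. t ^ hdist x y) = ((1 + t) / 2) ^ n"
proof -
  have *: "(\<Sum>y\<in>cube n. t ^ hdist x y) = (1 + t) ^ n"
    using assms
  proof (induction n arbitrary: x)
    case 0
    then show ?case
      by (simp add: cube_def)
  next
    case (Suc n)
    then obtain a x' where x: "x = a # x'" "length x' = n"
      by (auto simp: length_Suc_conv)
    have "cube (Suc n) = (\<lambda>(b, y). b # y) ` (UNIV \<times> cube n)"
      by (auto simp: cube_def length_Suc_conv image_iff)
    moreover have "inj_on (\<lambda>(b, y). b # y) (UNIV \<times> cube n)"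
      by (auto simp: inj_on_def)
    ultimately have "(\<Sum>y\<in>cube (Suc n). t ^ hdist x y) =
        (\<Sum>(b, y)\<in>UNIV \<times> cube n. t ^ hdist x (b # y))"
      by (simp add: sum.reindex split_def)
    also have "\<dots> = (\<Sum>b\<in>UNIV. \<Sum>y\<in>cube n. t ^ hdist x (b # y))"
      by (simp add: sum.cartesian_product)
    also have "\<dots> = (1 + t) * (\<Sum>y\<in>cube n. t ^ hdist x' y)"
      by (cases a) (simp_all add: UNIV_bool x hdist_Cons algebra_simps flip: sum_distrib_left)
    finally show ?case
      using Suc.IH[OF x(2)] by simp
  qed
  show ?thesis
    by (simp add: replicate_coin integral_pmf_of_set finite_cube cube_nonempty card_cube * power_divide)
qed

text \<open>Chernoff bound: Markov's inequality for \<open>u ^ (r * hdist x y)\<close>. The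
  threshold fraction is \<open>s / r\<close> with natural \<open>r\<close> and \<open>s\<close>, so
  that no real exponents arise.\<close>

lemma hdist_tail:
  fixes u :: real
  assumes "length x = n" "0 < u" "u < 1"
  shows "measure_pmf.prob (replicate_pmf n coin) {y. r * hdist x y < s * n}
    \<le> ((1 + u ^ r) / (2 * u ^ s)) ^ n"
proof -
  have "measure_pmf.prob (replicate_pmf n coin) {y. r * hdist x y < s * n}
      \<le> measure_pmf.expectation (replicate_pmf n coin) (\<lambda>y. (u ^ r) ^ hdist x y / (u ^ s) ^ n)"
  proof (rule markov_pmf)
    fix y assume "r * hdist x y < s * n"
    then have "u ^ (s * n) \<le> u ^ (r * hdist x y)"
      using assms by (intro power_decreasing) auto
    then show "1 \<le> (u ^ r) ^ hdist x y / (u ^ s) ^ n"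
      using assms by (simp add: power_mult)
  qed (use assms in \<open>auto simp: set_replicate_coin finite_cube\<close>)
  also have "\<dots> = ((1 + u ^ r) / 2) ^ n / (u ^ s) ^ n"
    by (simp add: expectation_power_hdist[OF assms(1)])
  also have "\<dots> = ((1 + u ^ r) / (2 * u ^ s)) ^ n"
    by (simp add: power_divide power_mult_distrib)
  finally show ?thesis .
qed

text \<open>The threshold 2/5 balances two needs: being below 1/2, it makes balls exponentially
  small, while points outside agree on at most 3/5 of the coordinates, and
  \<open>4 * (3 / 5) ^ 3 < 1\<close> is what the exponent \<open>k / 3\<close> requires.\<close>

definition near :: "bool list \<Rightarrow> bool list \<Rightarrow> bool" where
  "near x y \<longleftrightarrow> 5 * hdist x y < 2 * length x"

lemma prob_near:
  assumes "x \<in> cube n"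
  shows "measure_pmf.prob (replicate_pmf n coin) {y. near x y} \<le> (99 / 100) ^ (2 * n)"
proof -
  have "measure_pmf.prob (replicate_pmf n coin) {y. near x y}
      \<le> ((1 + (23 / 25) ^ 5) / (2 * (23 / 25) ^ 2)) ^ n"
    \<comment> \<open>23/25 approximates the optimal \<open>u\<close>, for which
      \<open>u ^ 5 = 2 / 3\<close>. The exponent \<open>2 * n\<close> provides two factors
      \<open>(99 / 100) ^ n\<close>, which are spent separately in
      \<open>error_bound\<close>.\<close>
    using hdist_tail[of x n "23 / 25" 5 2] assms by (simp add: near_def cube_def)
  also have "\<dots> \<le> ((99 / 100) ^ 2) ^ n"
    by (intro power_mono) (simp_all add: field_simps)
  finally show ?thesis
    by (simp add: power_mult)
qed

abbreviation proj :: "nat list \<Rightarrow> bool list \<Rightarrow> bool list" where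
  "proj p x \<equiv> map ((!) x) p"

text \<open>The projections agree iff all \<open>k\<close> independent coordinates of
  \<open>p\<close> fall among the positions where \<open>x\<close> and \<open>y\<close> agree, a
  fraction of at most 3/5.\<close>

lemma prob_proj_eq:
  assumes "x \<in> cube n" "n > 0" "\<not> near x y"
  shows "measure_pmf.prob (replicate_pmf k (pmf_of_set {..<n})) {p. proj p x = proj p y} \<le> (3 / 5) ^ k"
proof -
  let ?A = "{i. x ! i = y ! i}"
  have "card ({..<n} \<inter> ?A) + hdist x y = n"
  proof -
    have "{i. i < length x \<and> x ! i \<noteq> y ! i} = {..<n} - ?A"
      using assms by (auto simp: cube_def)
    then show ?thesis
      using card_Int_Diff[of "{..<n}" ?A] by (simp add: hdist_def)
  qed
  then have "5 * card ({..<n} \<inter> ?A) \<le> 3 * n"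
    using assms(1,3) by (simp add: near_def cube_def)
  then have "5 * real (card ({..<n} \<inter> ?A)) \<le> 3 * real n"
    by linarith
  then have "measure_pmf.prob (pmf_of_set {..<n}) ?A \<le> 3 / 5"
    using assms(2) by (simp add: measure_pmf_of_set lessThan_empty_iff field_simps)
  moreover have "{p. proj p x = proj p y} = {p. set p \<subseteq> ?A}"
    by auto
  ultimately show ?thesis
    by (simp add: prob_replicate_pmf_set_subset power_mono)
qed

section \<open>Juntas\<close>

text \<open>The relevant variables form a list that may contain repetitions, so that a random choice
  of them has independent entries.\<close>

definition lift_junta :: "nat list \<Rightarrow> (bool list \<Rightarrow> bool) \<Rightarrow> bool list \<Rightarrow> bool" where
  "lift_junta p h x = h (proj p x)"

lemma junta_lift_junta:
  assumes "length p = k"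
  shows "junta n k (lift_junta p h)"
proof -
  have "i \<in> set p" if "depends_on n (lift_junta p h) i" for i
  proof (rule ccontr)
    assume "i \<notin> set p"
    then have "proj p (x[i := b]) = proj p x" for x b
      by (intro map_cong refl nth_list_update_neq) auto
    then have "lift_junta p h (x[i := b]) = lift_junta p h x" for x b
      by (simp only: lift_junta_def)
    then show False
      using that by (simp add: depends_on_def)
  qed
  then have "card {i. i < n \<and> depends_on n (lift_junta p h) i} \<le> card (set p)"
    by (intro card_mono) auto
  also have "\<dots> \<le> k"
    using card_length[of p] assms by simp
  finally show ?thesis
    by (simp add: junta_def)
qed

text \<open>Hybrid argument: \<open>x\<close> is changed into \<open>y\<close> one coordinate at a
  time, and each step either changes nothing or flips a coordinate on which \<open>g\<close> does
  not depend.\<close>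

lemma eq_if_agree_on_dependencies:
  assumes "x \<in> cube n" "y \<in> cube n" "\<And>i. i < n \<Longrightarrow> depends_on n g i \<Longrightarrow> x ! i = y ! i"
  shows "g x = g y"
proof -
  have "g (take r y @ drop r x) = g x" if "r \<le> n" for r
    using that
  proof (induction r)
    case (Suc r)
    let ?z = "take r y @ drop r x"
    have r: "r < length x" "r < length y" "length x = n" "length y = n"
      using assms Suc.prems by (auto simp: cube_def)
    have upd: "take (Suc r) y @ drop (Suc r) x = ?z[r := y ! r]"
      by (rule nth_equalityI) (use r in \<open>auto simp: nth_append nth_list_update less_Suc_eq\<close>)
    have z: "?z ! r = x ! r" "?z \<in> cube n"
      using r by (auto simp: nth_append cube_def)
    have "g (take (Suc r) y @ drop (Suc r) x) = g ?z"
    proof (cases "x ! r = y ! r")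
      case True
      then have "?z[r := y ! r] = ?z"
        using z(1) list_update_id[of ?z r] by simp
      then show ?thesis
        by (simp only: upd)
    next
      case False
      then have "\<not> depends_on n g r"
        using assms(3)[of r] r by auto
      then have "g (?z[r := \<not> ?z ! r]) = g ?z"
        using z(2) by (auto simp: depends_on_def)
      moreover have "y ! r = (\<not> ?z ! r)"
        using False z(1) by auto
      ultimately show ?thesis
        by (simp only: upd)
    qed
    then show ?case
      using Suc by simp
  qed simp
  from this[of n] show ?thesis
    using assms by (simp add: cube_def)
qed

text \<open>Puts all juntas into a form that can be counted: there are at most
  \<open>n ^ k * 2 ^ 2 ^ k\<close> pairs of \<open>p\<close> and \<open>h\<close>.\<close>

lemma junta_as_lift:
  assumes "junta n k g" "n > 0"
  obtains p h where "set p \<subseteq> {..<n}" "length p = k" "h \<in> cube k \<rightarrow>\<^sub>E UNIV"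
    "\<And>x. x \<in> cube n \<Longrightarrow> g x = lift_junta p h x"
proof -
  let ?J = "{i. i < n \<and> depends_on n g i}"
  \<comment> \<open>Padding with coordinate 0 gives length exactly \<open>k\<close>. The table
    evaluates \<open>g\<close> at an arbitrary preimage; the choice does not matter since
    \<open>p\<close> contains all relevant coordinates.\<close>
  define p where "p = sorted_list_of_set ?J @ replicate (k - card ?J) 0"
  define h where "h = (\<lambda>w\<in>cube k. g (SOME x. x \<in> cube n \<and> proj p x = w))"
  have len: "length p = k"
    using assms(1) by (simp add: p_def junta_def)
  have J: "?J \<subseteq> set p"
    by (simp add: p_def)
  show thesis
  proof
    show "set p \<subseteq> {..<n}"
      using assms(2) by (auto simp: p_def)
    show "h \<in> cube k \<rightarrow>\<^sub>E UNIV"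
      by (simp add: h_def)
    show "g x = lift_junta p h x" if x: "x \<in> cube n" for x
    proof -
      define y where "y = (SOME y. y \<in> cube n \<and> proj p y = proj p x)"
      have y: "y \<in> cube n \<and> proj p y = proj p x"
        unfolding y_def by (rule someI[of _ x]) (use x in simp)
      have "x ! i = y ! i" if "i < n" "depends_on n g i" for i
      proof -
        have "i \<in> set p"
          using subsetD[OF J, of i] that by simp
        then show ?thesis
          using y by (metis map_eq_conv)
      qed
      then have "g x = g y"
        by (rule eq_if_agree_on_dependencies[OF x y[THEN conjunct1]])
      moreover have "lift_junta p h x = g y"
        by (simp only: lift_junta_def h_def y_def restrict_apply) (simp add: cube_def len)
      ultimately show ?thesis
        by simp
    qed
  qed (rule len)
qed


section \<open>Unrolling a non-adaptive algorithm\<close>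

text \<open>
  Entries of the sample list beyond those the algorithm asks for are ignored, so that a
  list of fixed length can be drawn in advance.
\<close>

primrec leaf :: "algorithm \<Rightarrow> (bool list \<times> bool) list \<Rightarrow> bool list list \<times> (bool list \<Rightarrow> bool)" where
  "leaf (Sample a) zs = leaf (a (hd zs)) (tl zs)"
| "leaf (Query Q d) zs = (Q, d)"

definition answer :: "(bool list \<Rightarrow> bool) \<Rightarrow> algorithm \<Rightarrow> bool list list \<Rightarrow> bool" where
  "answer f A xs = (case leaf A (map (\<lambda>x. (x, f x)) xs) of (Q, d) \<Rightarrow> d (map f Q))"

lemma cost_Sample_le:
  assumes "cost n f (Sample a) \<le> N"
  obtains M where "N = Suc M" "\<And>x. x \<in> cube n \<Longrightarrow> cost n f (a (x, f x)) \<le> M"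
proof (cases N)
  case (Suc M)
  then have "cost n f (a (x, f x)) \<le> M" if "x \<in> cube n" for x
    using assms that finite_cube[of n] by (auto dest: order_trans[rotated] intro: Max_ge order_trans)
  then show thesis
    using that Suc by blast
qed (use assms in simp)

text \<open>The cost counts samples as well, so on every path \<open>N\<close> draws made in advance
  are enough.\<close>

lemma verdict_eq_answer:
  assumes "set_pmf D \<subseteq> cube n" "cost n f A \<le> N"
  shows "verdict f D A = map_pmf (answer f A) (replicate_pmf N D)"
  using assms(2)
proof (induction A arbitrary: N)
  case (Sample a)
  obtain M where M: "N = Suc M" "\<And>x. x \<in> cube n \<Longrightarrow> cost n f (a (x, f x)) \<le> M"
    using cost_Sample_le[OF Sample.prems] by metis
  have "verdict f D (Sample a) =
      bind_pmf D (\<lambda>x. map_pmf (answer f (a (x, f x))) (replicate_pmf M D))"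
    unfolding verdict.simps
    by (intro bind_pmf_cong refl Sample.IH M(2)) (use assms(1) in auto)
  also have "\<dots> = map_pmf (answer f (Sample a)) (replicate_pmf N D)"
  proof -
    have "answer f (Sample a) (x # xs) = answer f (a (x, f x)) xs" for x xs
      by (simp add: answer_def)
    then show ?thesis
      by (simp add: M(1) map_bind_pmf) (simp add: map_pmf_def)
  qed
  finally show ?case .
next
  case (Query Q d)
  have "answer f (Query Q d) = (\<lambda>_. d (map f Q))"
    by (auto simp: answer_def)
  then show ?case
    by simp
qed

lemma leaf_queries:
  assumes "cost n f A \<le> length xs" "set xs \<subseteq> cube n" "queries_in_cube n A"
  shows "length (fst (leaf A (map (\<lambda>x. (x, f x)) xs))) \<le> length xs"
    and "set (fst (leaf A (map (\<lambda>x. (x, f x)) xs))) \<subseteq> cube n"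
proof -
  have "length (fst (leaf A (map (\<lambda>x. (x, f x)) xs))) \<le> length xs \<and>
      set (fst (leaf A (map (\<lambda>x. (x, f x)) xs))) \<subseteq> cube n"
    using assms
  proof (induction A arbitrary: xs)
    case (Sample a)
    obtain M where M: "length xs = Suc M" "\<And>x. x \<in> cube n \<Longrightarrow> cost n f (a (x, f x)) \<le> M"
      using cost_Sample_le[OF Sample.prems(1)] by metis
    then obtain y ys where xs: "xs = y # ys"
      by (cases xs) auto
    then show ?case
      using Sample.IH[of "a (y, f y)" ys] Sample.prems M
      by (auto intro: le_SucI)
  qed auto
  then show "length (fst (leaf A (map (\<lambda>x. (x, f x)) xs))) \<le> length xs"
    and "set (fst (leaf A (map (\<lambda>x. (x, f x)) xs))) \<subseteq> cube n"
    by auto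
qed

section \<open>Random labels on a sparse set of points\<close>

definition matches :: "bool list list \<Rightarrow> nat list \<Rightarrow> bool list \<Rightarrow> nat set" where
  "matches S p x = {i. i < length S \<and> near x (S ! i) \<and> proj p x = proj p (S ! i)}"

text \<open>
  Taking a closest match makes \<open>no_fun\<close> agree with the labels \<open>s\<close> on distinct points \<open>S\<close>,
  however close to each other these are.
\<close>

definition no_fun ::
    "bool list list \<Rightarrow> bool list \<Rightarrow> nat list \<Rightarrow> (bool list \<Rightarrow> bool) \<Rightarrow> bool list \<Rightarrow> bool" where
  "no_fun S s p h x =
    (if matches S p x = {} then h (proj p x)
     else s ! arg_min_on (\<lambda>i. hdist x (S ! i)) (matches S p x))"

lemma finite_matches: "finite (matches S p x)"
  by (simp add: matches_def)

text \<open>A sample point matches itself at distance 0, so a closest match has distance 0 too and,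
  by distinctness, is the same index.\<close>

lemma no_fun_sample:
  assumes "set S \<subseteq> cube n" "distinct S" "n > 0" "i < length S"
  shows "no_fun S s p h (S ! i) = s ! i"
proof -
  let ?C = "matches S p (S ! i)"
  define j where "j = arg_min_on (\<lambda>j. hdist (S ! i) (S ! j)) ?C"
  have len: "length (S ! j) = n" if "j < length S" for j
    using assms(1) nth_mem[OF that] by (auto simp: cube_def)
  have i: "i \<in> ?C"
    using assms len by (simp add: matches_def near_def)
  then have ne: "?C \<noteq> {}"
    by blast
  have "hdist (S ! i) (S ! j) \<le> hdist (S ! i) (S ! i)"
    unfolding j_def by (rule arg_min_least[OF finite_matches ne i])
  moreover have "j \<in> ?C"
    unfolding j_def by (rule arg_min_if_finite(1)[OF finite_matches ne])
  then have j: "j < length S"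
    by (simp add: matches_def)
  ultimately have "S ! i = S ! j"
    using len[OF j] len[OF assms(4)] hdist_eq_0_iff[of "S ! i" "S ! j"] by simp
  then have "j = i"
    using assms(2,4) j by (simp add: nth_eq_iff_index_eq)
  then show ?thesis
    using ne by (simp add: no_fun_def j_def)
qed

text \<open>
  The labels of the drawn points are exchanged with the values of the random junta at their
  projections. As this is a bijection, it turns a random junta into an equally distributed one.
\<close>

primrec swap_at ::
    "(nat \<Rightarrow> 'a) \<Rightarrow> nat list \<Rightarrow> bool list \<times> ('a \<Rightarrow> bool) \<Rightarrow> bool list \<times> ('a \<Rightarrow> bool)" where
  "swap_at w [] z = z"
| "swap_at w (i # is) z = swap_at w is ((fst z)[i := snd z (w i)], (snd z)(w i := fst z ! i))"

text \<open>A single exchange is an involution of the product, and \<open>swap_at\<close> composes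
  such exchanges.\<close>

lemma bij_betw_swap_at:
  assumes "\<forall>i\<in>set is. i < m \<and> w i \<in> X"
  shows "bij_betw (swap_at w is) (cube m \<times> (X \<rightarrow>\<^sub>E UNIV)) (cube m \<times> (X \<rightarrow>\<^sub>E UNIV))"
  using assms
proof (induction "is")
  case Nil
  show ?case
    by (rule bij_betw_cong[THEN iffD1, OF _ bij_betw_id]) simp
next
  case (Cons i "is")
  let ?g = "\<lambda>z. ((fst z)[i := snd z (w i)], (snd z)(w i := fst z ! i))"
  have i: "i < m" "w i \<in> X"
    using Cons.prems by auto
  have "bij_betw ?g (cube m \<times> (X \<rightarrow>\<^sub>E UNIV)) (cube m \<times> (X \<rightarrow>\<^sub>E UNIV))"
    by (rule bij_betw_byWitness[where f' = ?g])
      (use i in \<open>auto simp: cube_def PiE_def extensional_def split: if_splits\<close>)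
  from bij_betw_trans[OF this Cons.IH] Cons.prems show ?case
    by (simp add: comp_def)
qed

lemma swap_at_outside: "v \<notin> w ` set is \<Longrightarrow> snd (swap_at w is z) v = snd z v"
  by (induction "is" arbitrary: z) auto

lemma swap_at_inside:
  assumes "distinct is" "inj_on w (set is)" "i \<in> set is"
  shows "snd (swap_at w is z) (w i) = fst z ! i"
  using assms
proof (induction "is" arbitrary: z)
  case (Cons j "is")
  then show ?case
    by (cases "i = j") (auto simp: swap_at_outside)
qed simp

text \<open>The filler \<open>replicate n True\<close> gives every index \<open>l\<close> a point of
  the cube, so that union bounds range over a fixed index set although the batch length
  varies.\<close>

definition query_point :: "nat \<Rightarrow> algorithm \<Rightarrow> (bool list \<times> bool) list \<Rightarrow> nat \<Rightarrow> bool list" where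
  "query_point n A zs l =
    (let Q = fst (leaf A zs) in if l < length Q \<and> Q ! l \<in> cube n then Q ! l else replicate n True)"

lemma query_point_in_cube [simp]: "query_point n A zs l \<in> cube n"
  by (simp add: query_point_def Let_def cube_def)

text \<open>With labels taken from \<open>s\<close> instead of from a function, the query batch is
  determined by the drawn entries alone: it does not depend on \<open>p\<close>, \<open>h\<close> or
  the undrawn points. This is where non-adaptivity enters.\<close>

definition labelled :: "bool list list \<Rightarrow> bool list \<Rightarrow> nat list \<Rightarrow> (bool list \<times> bool) list" where
  "labelled S s is = map (\<lambda>i. (S ! i, s ! i)) is"

text \<open>\<open>I\<close> holds the indices of the points that \<open>x\<close> may be close to:
  \<open>{i}\<close> for a drawn point, all drawn indices for a query. If \<open>x\<close> has the
  projection of a drawn point \<open>i\<close>, then \<open>i\<close> is the only match and the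
  exchanged table holds \<open>s ! i\<close> there; otherwise the table entry is untouched and there
  is no match. Indices can be drawn repeatedly; \<open>remdups\<close> keeps a second exchange from
  undoing the first.\<close>

lemma lift_junta_swap_eq_no_fun:
  assumes x: "\<And>j. j < length S \<Longrightarrow> j \<notin> I \<Longrightarrow> \<not> near x (S ! j)"
      "\<And>i. i \<in> set is \<Longrightarrow> proj p x = proj p (S ! i) \<Longrightarrow> near x (S ! i)"
    and I: "I \<subseteq> set is"
    and inj: "inj_on (\<lambda>i. proj p (S ! i)) (set is)"
    and "is": "set is \<subseteq> {..<length S}"
  shows "lift_junta p (snd (swap_at (\<lambda>i. proj p (S ! i)) (remdups is) (s, h))) x = no_fun S s p h x"
proof (cases "\<exists>i\<in>set is. proj p x = proj p (S ! i)")
  case True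
  then obtain i where i: "i \<in> set is" "proj p x = proj p (S ! i)"
    by auto
  have "matches S p x = {i}"
  proof
    show "matches S p x \<subseteq> {i}"
    proof
      fix j assume j: "j \<in> matches S p x"
      then have "j \<in> set is"
        using x(1) I by (auto simp: matches_def)
      moreover have "proj p (S ! j) = proj p (S ! i)"
        using j i(2) by (simp add: matches_def)
      ultimately show "j \<in> {i}"
        using inj_onD[OF inj] i(1) by blast
    qed
  qed (use x(2) i "is" in \<open>auto simp: matches_def\<close>)
  then have "no_fun S s p h x = s ! i"
    using arg_min_if_finite(1)[OF finite_matches[of S p x], of "\<lambda>i. hdist x (S ! i)"]
    by (simp add: no_fun_def)
  then show ?thesis
    using swap_at_inside[of "remdups is" "\<lambda>i. proj p (S ! i)" i "(s, h)"] inj i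
    by (simp add: lift_junta_def del: map_eq_conv)
next
  case False
  then have "matches S p x = {}"
    using x(1) I by (auto simp: matches_def)
  then show ?thesis
    using swap_at_outside[of "proj p x" "\<lambda>i. proj p (S ! i)" "remdups is" "(s, h)"] False
    by (simp add: lift_junta_def no_fun_def image_iff del: map_eq_conv)
qed

text \<open>Both functions give the drawn points their labels from \<open>s\<close>, hence lead to
  the same leaf and the same batch, and on this batch they agree by
  \<open>lift_junta_swap_eq_no_fun\<close>.\<close>

lemma answer_coupling:
  assumes S: "set S \<subseteq> cube n" "length is = N" "set is \<subseteq> {..<length S}" "n > 0"
    and A: "queries_in_cube n A" "\<And>f. cost n f A \<le> N"
    and sample_near: "\<And>a j. a < N \<Longrightarrow> j < length S \<Longrightarrow> j \<noteq> is ! a \<Longrightarrow> \<not> near (S ! (is ! a)) (S ! j)"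
    and query_near: "\<And>l j. l < N \<Longrightarrow> j < length S \<Longrightarrow> j \<notin> set is \<Longrightarrow>
      \<not> near (query_point n A (labelled S s is) l) (S ! j)"
    and sample_proj: "\<And>a b. a < N \<Longrightarrow> b < N \<Longrightarrow> proj p (S ! (is ! a)) = proj p (S ! (is ! b)) \<Longrightarrow>
      near (S ! (is ! a)) (S ! (is ! b))"
    and query_proj: "\<And>l b. l < N \<Longrightarrow> b < N \<Longrightarrow>
      proj p (query_point n A (labelled S s is) l) = proj p (S ! (is ! b)) \<Longrightarrow>
      near (query_point n A (labelled S s is) l) (S ! (is ! b))"
  shows "answer (lift_junta p (snd (swap_at (\<lambda>i. proj p (S ! i)) (remdups is) (s, h)))) A
      (map ((!) S) is) = answer (no_fun S s p h) A (map ((!) S) is)"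
proof -
  let ?f = "lift_junta p (snd (swap_at (\<lambda>i. proj p (S ! i)) (remdups is) (s, h)))"
  let ?g = "no_fun S s p h"
  let ?Q = "fst (leaf A (labelled S s is))"
  have sample_near': "\<not> near (S ! i) (S ! j)" if "i \<in> set is" "j < length S" "j \<noteq> i" for i j
    using that sample_near S(2) by (auto simp: in_set_conv_nth)
  have sample_proj': "near (S ! i) (S ! j)"
    if "i \<in> set is" "j \<in> set is" "proj p (S ! i) = proj p (S ! j)" for i j
    using that sample_proj S(2) by (auto simp: in_set_conv_nth)
  \<comment> \<open>Equal projections force closeness, but a drawn point is close to no entry of
    \<open>S\<close> with another index.\<close>
  have inj: "inj_on (\<lambda>i. proj p (S ! i)) (set is)"
    using sample_near' sample_proj' S(3) by (intro inj_onI) blast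
  have sample: "?f (S ! i) = ?g (S ! i)" if "i \<in> set is" for i
    by (rule lift_junta_swap_eq_no_fun[where I = "{i}"])
      (use that S(3) inj sample_near' sample_proj' in auto)
  have label: "?f (S ! i) = s ! i" if "i \<in> set is" for i
    using swap_at_inside[of "remdups is" "\<lambda>i. proj p (S ! i)" i "(s, h)"] inj that
    by (simp add: lift_junta_def)
  have lab: "map (\<lambda>x. (x, ?f x)) (map ((!) S) is) = labelled S s is"
    using label by (simp add: labelled_def)
  moreover have "map (\<lambda>x. (x, ?g x)) (map ((!) S) is) = labelled S s is"
    using label sample by (simp add: labelled_def)
  moreover have "?f x = ?g x" if x_in: "x \<in> set ?Q" for x
  proof -
    have "set (map ((!) S) is) \<subseteq> cube n"
      using S(1,3) by (auto intro: subsetD[OF _ nth_mem])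
    then have Q: "length ?Q \<le> N" "set ?Q \<subseteq> cube n"
      using leaf_queries[of n ?f A "map ((!) S) is"] A S(2) unfolding lab by auto
    obtain l where l: "l < length ?Q" "x = ?Q ! l"
      using x_in by (auto simp: in_set_conv_nth)
    have "?Q ! l \<in> cube n"
      using subsetD[OF Q(2) nth_mem[OF l(1)]] .
    then have x: "x = query_point n A (labelled S s is) l" "l < N"
      using Q(1) l by (simp_all add: query_point_def)
    show ?thesis
    proof (rule lift_junta_swap_eq_no_fun[where I = "set is"])
      show "\<not> near x (S ! j)" if "j < length S" "j \<notin> set is" for j
        using query_near[OF x(2) that] by (simp only: x(1) not_False_eq_True)
      show "near x (S ! i)" if i: "i \<in> set is" "proj p x = proj p (S ! i)" for i
      proof -
        obtain b where "b < N" "i = is ! b"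
          using i(1) S(2) by (auto simp: in_set_conv_nth)
        then show ?thesis
          using query_proj[OF x(2), of b] i(2) by (simp only: x(1))
      qed
    qed (rule subset_refl inj S(3))+
  qed
  then have "map ?f ?Q = map ?g ?Q"
    by (intro map_cong refl)
  ultimately show ?thesis
    unfolding answer_def by (simp only: split_beta)
qed


section \<open>Random instances\<close>

abbreviation points_pmf :: "nat \<Rightarrow> nat \<Rightarrow> bool list list pmf" where
  "points_pmf m n \<equiv> replicate_pmf m (replicate_pmf n coin)"

text \<open>Tables are extensional outside \<open>cube k\<close>, so there are finitely many and a
  uniform one exists.\<close>

abbreviation table_pmf :: "nat \<Rightarrow> (bool list \<Rightarrow> bool) pmf" where
  "table_pmf k \<equiv> pmf_of_set (cube k \<rightarrow>\<^sub>E UNIV)"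

text \<open>Yes- and no-instances are read off the same independent tuple of points, coordinates,
  labels and table, which allows them to be coupled.\<close>

definition instance_pmf ::
    "nat \<Rightarrow> nat \<Rightarrow> nat \<Rightarrow> (bool list list \<times> nat list \<times> bool list \<times> (bool list \<Rightarrow> bool)) pmf" where
  "instance_pmf n m k = pair_pmf (points_pmf m n)
    (pair_pmf (replicate_pmf k (pmf_of_set {..<n})) (pair_pmf (replicate_pmf m coin) (table_pmf k)))"

text \<open>Drawing indices rather than points lets the drawn positions be fixed before
  \<open>S\<close> is chosen; coinciding points count with multiplicity.\<close>

definition dist_on :: "bool list list \<Rightarrow> bool list pmf" where
  "dist_on S = map_pmf ((!) S) (pmf_of_set {..<length S})"

lemma finite_tables: "finite (cube k \<rightarrow>\<^sub>E (UNIV :: bool set))"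
  by (intro finite_PiE) (auto simp: finite_cube)

lemma tables_nonempty: "(cube k \<rightarrow>\<^sub>E (UNIV :: bool set)) \<noteq> {}"
  by (simp add: PiE_eq_empty_iff)

lemma set_points_pmf: "S \<in> set_pmf (points_pmf m n) \<longleftrightarrow> length S = m \<and> set S \<subseteq> cube n"
  unfolding set_replicate_pmf[of m] set_replicate_coin by (auto simp: lists_eq_set)

lemma set_replicate_uniform:
  "(n :: nat) > 0 \<Longrightarrow> set_pmf (replicate_pmf r (pmf_of_set {..<n})) = {xs. set xs \<subseteq> {..<n} \<and> length xs = r}"
  by (subst set_replicate_pmf, subst set_pmf_of_set) (auto simp: lists_eq_set lessThan_empty_iff)

lemma set_instance_pmf:
  assumes "(S, p, s, h) \<in> set_pmf (instance_pmf n m k)" "n > 0"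
  shows "length S = m" "set S \<subseteq> cube n" "length p = k" "set p \<subseteq> {..<n}" "length s = m"
  using assms set_points_pmf set_replicate_uniform[of n k]
  by (auto simp: instance_pmf_def set_replicate_coin cube_def)

section \<open>Invariance of the instances under the exchange\<close>

lemma map_swap_at_pair:
  assumes "set is \<subseteq> {..<m}" "length p = k"
  shows "map_pmf (swap_at (\<lambda>i. proj p (S ! i)) is) (pair_pmf (replicate_pmf m coin) (table_pmf k)) =
    pair_pmf (replicate_pmf m coin) (table_pmf k)"
proof -
  have "bij_betw (swap_at (\<lambda>i. proj p (S ! i)) is)
      (cube m \<times> (cube k \<rightarrow>\<^sub>E UNIV)) (cube m \<times> (cube k \<rightarrow>\<^sub>E UNIV))"
    by (rule bij_betw_swap_at) (use assms in \<open>auto simp: cube_def\<close>)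
  then show ?thesis
    unfolding replicate_coin
      pair_pmf_of_set[OF finite_cube cube_nonempty finite_tables tables_nonempty]
    by (rule map_pmf_of_set_bij_betw) (simp_all add: finite_cube finite_tables cube_nonempty tables_nonempty)
qed

lemma map_instance_swap:
  assumes "set is \<subseteq> {..<m}" "n > 0"
  shows "map_pmf (\<lambda>(S, p, s, h). F S p h) (instance_pmf n m k) =
    map_pmf (\<lambda>(S, p, s, h). F S p (snd (swap_at (\<lambda>i. proj p (S ! i)) is (s, h)))) (instance_pmf n m k)"
proof -
  let ?P = "replicate_pmf k (pmf_of_set {..<n})"
  let ?L = "pair_pmf (replicate_pmf m coin) (table_pmf k)"
  have expand: "map_pmf (\<lambda>(S, p, s, h). G S p (s, h)) (instance_pmf n m k) =
      bind_pmf (points_pmf m n) (\<lambda>S. bind_pmf ?P (\<lambda>p. map_pmf (G S p) ?L))"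
    for G :: "bool list list \<Rightarrow> nat list \<Rightarrow> bool list \<times> (bool list \<Rightarrow> bool) \<Rightarrow> 'a"
  proof -
    have *: "pair_pmf p q = bind_pmf p (\<lambda>x. map_pmf (Pair x) q)" for p :: "'x pmf" and q :: "'y pmf"
      by (simp add: pair_pmf_def map_pmf_def)
    show ?thesis
      unfolding instance_pmf_def *[of "points_pmf m n"] *[of ?P]
      by (simp add: map_bind_pmf map_pmf_comp split_def)
  qed
  have "map_pmf (\<lambda>z. F S p (snd z)) ?L =
      map_pmf (\<lambda>z. F S p (snd (swap_at (\<lambda>i. proj p (S ! i)) is z))) ?L"
    if "p \<in> set_pmf ?P" for S p
  proof -
    have "length p = k"
      using that assms(2) by (simp add: set_replicate_uniform)
    have "map_pmf (\<lambda>z. F S p (snd z)) ?L =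
        map_pmf (\<lambda>z. F S p (snd z)) (map_pmf (swap_at (\<lambda>i. proj p (S ! i)) is) ?L)"
      by (simp only: map_swap_at_pair[OF assms(1) \<open>length p = k\<close>])
    then show ?thesis
      by (simp only: map_pmf_comp)
  qed
  then have "bind_pmf (points_pmf m n) (\<lambda>S. bind_pmf ?P (\<lambda>p. map_pmf (\<lambda>z. F S p (snd z)) ?L)) =
      bind_pmf (points_pmf m n) (\<lambda>S. bind_pmf ?P
        (\<lambda>p. map_pmf (\<lambda>z. F S p (snd (swap_at (\<lambda>i. proj p (S ! i)) is z))) ?L))"
    by (intro bind_pmf_cong refl)
  then show ?thesis
    using expand[of "\<lambda>S p z. F S p (snd z)"]
      expand[of "\<lambda>S p z. F S p (snd (swap_at (\<lambda>i. proj p (S ! i)) is z))"]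
    by simp
qed

section \<open>Probabilities of the bad events\<close>

lemma prob_points_entry_near:
  assumes "j < m" "\<And>S y. length S = m \<Longrightarrow> g (S[j := y]) = g S"
    "\<And>S. length S = m \<Longrightarrow> set S \<subseteq> cube n \<Longrightarrow> g S \<in> cube n"
  shows "measure_pmf.prob (points_pmf m n) {S. near (g S) (S ! j)} \<le> (99 / 100) ^ (2 * n)"
  by (rule prob_replicate_pmf_entry[OF assms(1,2)]) (use assms(3) in \<open>auto simp: set_points_pmf intro: prob_near\<close>)

lemma prob_sample_near:
  assumes "set is \<subseteq> {..<m}" "length is = N"
  shows "measure_pmf.prob (points_pmf m n)
      {S. \<exists>z\<in>{..<N} \<times> {..<m}. snd z \<noteq> is ! fst z \<and> near (S ! (is ! fst z)) (S ! snd z)}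
    \<le> real (N * m) * (99 / 100) ^ (2 * n)"
proof -
  have "measure_pmf.prob (points_pmf m n)
      {S. snd z \<noteq> is ! fst z \<and> near (S ! (is ! fst z)) (S ! snd z)} \<le> (99 / 100) ^ (2 * n)"
    if z: "z \<in> {..<N} \<times> {..<m}" for z
  proof (cases "snd z = is ! fst z")
    case False
    have "is ! fst z < m"
      using z assms subsetD[OF assms(1) nth_mem, of "fst z"] by auto
    then show ?thesis
      using False z by (auto intro!: prob_points_entry_near)
  qed simp
  from prob_union_bound[OF _ this, of "{..<N} \<times> {..<m}" "\<lambda>z. z"] show ?thesis
    by (simp add: card_cartesian_product)
qed

text \<open>The queries depend only on \<open>s\<close> and the drawn entries, so an undrawn entry
  is still uniform once they are fixed.\<close>

lemma prob_query_near:
  "measure_pmf.prob (points_pmf m n)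
      {S. \<exists>z\<in>{..<N} \<times> {..<m}. snd z \<notin> set is \<and>
        near (query_point n A (labelled S s is) (fst z)) (S ! snd z)}
    \<le> real (N * m) * (99 / 100) ^ (2 * n)"
proof -
  have "measure_pmf.prob (points_pmf m n)
      {S. snd z \<notin> set is \<and> near (query_point n A (labelled S s is) (fst z)) (S ! snd z)}
      \<le> (99 / 100) ^ (2 * n)"
    if z: "z \<in> {..<N} \<times> {..<m}" for z
  proof (cases "snd z \<in> set is")
    case False
    then have "labelled (S[snd z := y]) s is = labelled S s is" for S y
      unfolding labelled_def
      by (intro map_cong refl arg_cong2[where f = Pair] nth_list_update_neq) auto
    then show ?thesis
      using False z by (auto intro!: prob_points_entry_near)
  qed simp
  from prob_union_bound[OF _ this, of "{..<N} \<times> {..<m}" "\<lambda>z. z"] show ?thesis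
    by (simp add: card_cartesian_product)
qed

lemma prob_far_same_proj:
  assumes "n > 0" "\<And>a. a < N \<Longrightarrow> x a \<in> cube n"
  shows "measure_pmf.prob (replicate_pmf k (pmf_of_set {..<n}))
      {p. \<exists>z\<in>{..<N} \<times> {..<N}. \<not> near (x (fst z)) (y (snd z)) \<and> proj p (x (fst z)) = proj p (y (snd z))}
    \<le> real (N * N) * (3 / 5) ^ k"
proof -
  have "measure_pmf.prob (replicate_pmf k (pmf_of_set {..<n}))
      {p. \<not> near (x (fst z)) (y (snd z)) \<and> proj p (x (fst z)) = proj p (y (snd z))} \<le> (3 / 5) ^ k"
    if "z \<in> {..<N} \<times> {..<N}" for z
    using that assms prob_proj_eq[of "x (fst z)" n "y (snd z)" k]
    by (cases "near (x (fst z)) (y (snd z))") auto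
  from prob_union_bound[OF _ this, of "{..<N} \<times> {..<N}" "\<lambda>z. z"] show ?thesis
    by (simp add: card_cartesian_product)
qed


text \<open>By independence it suffices to bound the event with the other components fixed. The next
  two lemmas do the same with \<open>p\<close> and \<open>s\<close> as the random component.\<close>

lemma prob_instance_points:
  assumes "\<And>p s h. measure_pmf.prob (points_pmf m n) {S. P S p s h} \<le> b"
  shows "measure_pmf.prob (instance_pmf n m k) {(S, p, s, h). P S p s h} \<le> b"
  unfolding instance_pmf_def by (rule prob_pair_pmf_le_snd) (use assms in \<open>auto simp: split_def\<close>)

lemma prob_instance_proj:
  assumes "\<And>S s h. length S = m \<Longrightarrow> set S \<subseteq> cube n \<Longrightarrow>
    measure_pmf.prob (replicate_pmf k (pmf_of_set {..<n})) {p. P S p s h} \<le> b"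
  shows "measure_pmf.prob (instance_pmf n m k) {(S, p, s, h). P S p s h} \<le> b"
  unfolding instance_pmf_def
proof (rule prob_pair_pmf_le_fst)
  fix S assume "S \<in> set_pmf (points_pmf m n)"
  then have "length S = m" "set S \<subseteq> cube n"
    by (auto simp only: set_points_pmf)
  then show "measure_pmf.prob (pair_pmf (replicate_pmf k (pmf_of_set {..<n}))
      (pair_pmf (replicate_pmf m coin) (table_pmf k))) {(p, s, h). P S p s h} \<le> b"
    by (intro prob_pair_pmf_le_snd) (use assms in \<open>auto simp: split_def\<close>)
qed

lemma prob_instance_labels:
  assumes "\<And>S p h. length S = m \<Longrightarrow> set S \<subseteq> cube n \<Longrightarrow>
    measure_pmf.prob (replicate_pmf m coin) {s. P S p s h} \<le> b"
  shows "measure_pmf.prob (instance_pmf n m k) {(S, p, s, h). P S p s h} \<le> b"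
  unfolding instance_pmf_def
proof (rule prob_pair_pmf_le_fst)
  fix S assume "S \<in> set_pmf (points_pmf m n)"
  then have S: "length S = m" "set S \<subseteq> cube n"
    by (auto simp only: set_points_pmf)
  show "measure_pmf.prob (pair_pmf (replicate_pmf k (pmf_of_set {..<n}))
      (pair_pmf (replicate_pmf m coin) (table_pmf k))) {(p, s, h). P S p s h} \<le> b"
  proof (rule prob_pair_pmf_le_fst)
    fix p
    show "measure_pmf.prob (pair_pmf (replicate_pmf m coin) (table_pmf k)) {(s, h). P S p s h} \<le> b"
      by (rule prob_pair_pmf_le_snd) (rule assms[OF S])
  qed
qed

section \<open>Comparison of the acceptance probabilities\<close>

lemma verdict_dist_on:
  assumes "set S \<subseteq> cube n" "length S = m" "m > 0" "cost n f A \<le> N"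
  shows "verdict f (dist_on S) A =
    map_pmf (\<lambda>is. answer f A (map ((!) S) is)) (replicate_pmf N (pmf_of_set {..<m}))"
proof -
  have "set_pmf (dist_on S) \<subseteq> cube n"
    using assms(2,3) subsetD[OF assms(1) nth_mem] by (auto simp: dist_on_def lessThan_empty_iff)
  from verdict_eq_answer[OF this assms(4)] show ?thesis
    using assms(2) by (simp add: dist_on_def replicate_pmf_map map_pmf_comp)
qed

text \<open>For fixed drawn indices, the yes-side is rewritten with the exchanged table; outside
  four bad events it then gives the same answer as the no-side on the same tuple.\<close>

lemma yes_no_difference:
  fixes n m N k :: nat
  assumes "n > 0" "m > 0" and A: "queries_in_cube n A" "\<And>f. cost n f A \<le> N"
  defines "\<beta> \<equiv> 2 * (real (N * m) * (99 / 100) ^ (2 * n)) + 2 * (real (N * N) * (3 / 5) ^ k)"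
  shows "pmf (bind_pmf (instance_pmf n m k) (\<lambda>(S, p, s, h). verdict (lift_junta p h) (dist_on S) A)) True
    \<le> pmf (bind_pmf (instance_pmf n m k) (\<lambda>(S, p, s, h). verdict (no_fun S s p h) (dist_on S) A)) True + \<beta>"
proof -
  let ?I = "replicate_pmf N (pmf_of_set {..<m})"
  let ?P = "instance_pmf n m k"
  \<comment> \<open>The indices are drawn before the instance, so that the places to be exchanged
    are known.\<close>
  have unroll: "bind_pmf ?P (\<lambda>(S, p, s, h). verdict (F S p s h) (dist_on S) A) =
      bind_pmf ?I (\<lambda>is. map_pmf (\<lambda>(S, p, s, h). answer (F S p s h) A (map ((!) S) is)) ?P)" for F
  proof -
    have "bind_pmf ?P (\<lambda>(S, p, s, h). verdict (F S p s h) (dist_on S) A) =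
        bind_pmf ?P (\<lambda>z. bind_pmf ?I
          (\<lambda>is. return_pmf (case z of (S, p, s, h) \<Rightarrow> answer (F S p s h) A (map ((!) S) is))))"
    proof (intro bind_pmf_cong refl)
      fix z assume "z \<in> set_pmf ?P"
      moreover obtain S p s h where "z = (S, p, s, h)"
        by (cases z) auto
      ultimately show "(case z of (S, p, s, h) \<Rightarrow> verdict (F S p s h) (dist_on S) A) =
          bind_pmf ?I (\<lambda>is. return_pmf (case z of (S, p, s, h) \<Rightarrow> answer (F S p s h) A (map ((!) S) is)))"
        using verdict_dist_on[of S n m "F S p s h" A N] set_instance_pmf[of S p s h n m k] assms(1,2) A(2)
        by (simp add: map_pmf_def)
    qed
    then show ?thesis
      by (subst (asm) bind_commute_pmf) (simp only: map_pmf_def)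
  qed
  show ?thesis
    unfolding unroll
  proof (rule pmf_bind_mono)
    fix "is" assume "is \<in> set_pmf ?I"
    then have "is": "set is \<subseteq> {..<m}" "length is = N"
      using set_replicate_uniform[OF assms(2)] by auto
    let ?q = "\<lambda>S s l. query_point n A (labelled S s is) l"
    \<comment> \<open>The four ways in which the hypotheses of \<open>answer_coupling\<close> can
      fail; the first two are bounded over random \<open>S\<close>, the last two over random
      \<open>p\<close>.\<close>
    define E1 where "E1 S \<longleftrightarrow> (\<exists>z\<in>{..<N} \<times> {..<m}. snd z \<noteq> is ! fst z \<and>
        near (S ! (is ! fst z)) (S ! snd z))" for S
    define E2 where "E2 S s \<longleftrightarrow> (\<exists>z\<in>{..<N} \<times> {..<m}. snd z \<notin> set is \<and> near (?q S s (fst z)) (S ! snd z))"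
      for S s
    define E3 where "E3 S p \<longleftrightarrow> (\<exists>z\<in>{..<N} \<times> {..<N}. \<not> near (S ! (is ! fst z)) (S ! (is ! snd z)) \<and>
        proj p (S ! (is ! fst z)) = proj p (S ! (is ! snd z)))" for S p
    define E4 where "E4 S p s \<longleftrightarrow> (\<exists>z\<in>{..<N} \<times> {..<N}. \<not> near (?q S s (fst z)) (S ! (is ! snd z)) \<and>
        proj p (?q S s (fst z)) = proj p (S ! (is ! snd z)))" for S p s
    let ?yes = "\<lambda>S p s h. answer (lift_junta p h) A (map ((!) S) is)"
    let ?yes' = "\<lambda>S p s h. answer (lift_junta p
        (snd (swap_at (\<lambda>i. proj p (S ! i)) (remdups is) (s, h)))) A (map ((!) S) is)"
    let ?no = "\<lambda>S p s h. answer (no_fun S s p h) A (map ((!) S) is)"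
    \<comment> \<open>\<open>?yes\<close> ignores its label argument, so \<open>undefined\<close>
      can take its place.\<close>
    have "pmf (map_pmf (\<lambda>(S, p, s, h). ?yes S p s h) ?P) True =
        measure_pmf.prob ?P {(S, p, s, h). ?yes' S p s h}"
      using map_instance_swap[of "remdups is" m n "\<lambda>S p h. ?yes S p undefined h" k] "is" assms(1)
      by (simp add: pmf_map vimage_def split_def)
    also have "\<dots> \<le> measure_pmf.prob ?P
        {(S, p, s, h). ?no S p s h \<or> E1 S \<or> E2 S s \<or> E3 S p \<or> E4 S p s}"
    proof (rule prob_mono_pmf)
      fix z assume z: "z \<in> set_pmf ?P" "case z of (S, p, s, h) \<Rightarrow> ?yes' S p s h"
      obtain S p s h where [simp]: "z = (S, p, s, h)"
        by (cases z) auto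
      note S = set_instance_pmf[OF z(1)[simplified] assms(1)]
      have "?yes' S p s h = ?no S p s h" if good: "\<not> E1 S" "\<not> E2 S s" "\<not> E3 S p" "\<not> E4 S p s"
      proof (rule answer_coupling[OF S(2) "is"(2) _ assms(1) A])
        show "set is \<subseteq> {..<length S}"
          using "is"(1) S(1) by simp
        show "\<not> near (S ! (is ! a)) (S ! j)" if "a < N" "j < length S" "j \<noteq> is ! a" for a j
          using good(1) that S(1) unfolding E1_def by fastforce
        show "\<not> near (?q S s l) (S ! j)" if "l < N" "j < length S" "j \<notin> set is" for l j
          using good(2) that S(1) unfolding E2_def by fastforce
        show "near (S ! (is ! a)) (S ! (is ! b))"
          if "a < N" "b < N" "proj p (S ! (is ! a)) = proj p (S ! (is ! b))" for a b
          using good(3) that unfolding E3_def by fastforce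
        show "near (?q S s l) (S ! (is ! b))"
          if "l < N" "b < N" "proj p (?q S s l) = proj p (S ! (is ! b))" for l b
          using good(4) that unfolding E4_def by fastforce
      qed
      then show "case z of (S, p, s, h) \<Rightarrow> ?no S p s h \<or> E1 S \<or> E2 S s \<or> E3 S p \<or> E4 S p s"
        using z(2) by auto
    qed
    also have "\<dots> \<le> measure_pmf.prob ?P {(S, p, s, h). ?no S p s h} +
        (measure_pmf.prob ?P {(S, p, s, h). E1 S} + (measure_pmf.prob ?P {(S, p, s, h). E2 S s} +
          (measure_pmf.prob ?P {(S, p, s, h). E3 S p} + measure_pmf.prob ?P {(S, p, s, h). E4 S p s})))"
      unfolding split_def by (intro order_trans[OF prob_disj_le] add_left_mono order_refl)
    also have "\<dots> \<le> measure_pmf.prob ?P {(S, p, s, h). ?no S p s h} +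
        (real (N * m) * (99 / 100) ^ (2 * n) + (real (N * m) * (99 / 100) ^ (2 * n) +
          (real (N * N) * (3 / 5) ^ k + real (N * N) * (3 / 5) ^ k)))"
    proof (intro add_left_mono add_mono)
      show "measure_pmf.prob ?P {(S, p, s, h). E1 S} \<le> real (N * m) * (99 / 100) ^ (2 * n)"
        unfolding E1_def by (rule prob_instance_points[OF prob_sample_near[OF "is"]])
      show "measure_pmf.prob ?P {(S, p, s, h). E2 S s} \<le> real (N * m) * (99 / 100) ^ (2 * n)"
        unfolding E2_def by (rule prob_instance_points[OF prob_query_near])
      show "measure_pmf.prob ?P {(S, p, s, h). E3 S p} \<le> real (N * N) * (3 / 5) ^ k"
        unfolding E3_def
      proof (rule prob_instance_proj)
        fix S assume S: "length S = m" "set S \<subseteq> cube n"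
        have "S ! (is ! a) \<in> cube n" if "a < N" for a
          using subsetD[OF "is"(1) nth_mem, of a] S that "is"(2) by auto
        then show "measure_pmf.prob (replicate_pmf k (pmf_of_set {..<n})) {p. \<exists>z\<in>{..<N} \<times> {..<N}.
            \<not> near (S ! (is ! fst z)) (S ! (is ! snd z)) \<and>
            proj p (S ! (is ! fst z)) = proj p (S ! (is ! snd z))} \<le> real (N * N) * (3 / 5) ^ k"
          by (rule prob_far_same_proj[OF assms(1),
                where x = "\<lambda>a. S ! (is ! a)" and y = "\<lambda>a. S ! (is ! a)"])
      qed
      show "measure_pmf.prob ?P {(S, p, s, h). E4 S p s} \<le> real (N * N) * (3 / 5) ^ k"
        unfolding E4_def
        by (rule prob_instance_proj)
          (rule prob_far_same_proj[OF assms(1) query_point_in_cube])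
    qed
    also have "\<dots> = pmf (map_pmf (\<lambda>(S, p, s, h). ?no S p s h) ?P) True + \<beta>"
      by (simp add: \<beta>_def pmf_map vimage_def split_def)
    finally show "pmf (map_pmf (\<lambda>(S, p, s, h). ?yes S p s h) ?P) True
        \<le> pmf (map_pmf (\<lambda>(S, p, s, h). ?no S p s h) ?P) True + \<beta>" .
  qed
qed

section \<open>Random labels are far from juntas\<close>

text \<open>On distinct points the no-function has the labels \<open>s\<close>, so its distance from
  a junta is the fraction of \<open>S\<close> on which that junta disagrees with
  \<open>s\<close>.\<close>

lemma far_from_juntas_no_fun:
  assumes "length S = m" "set S \<subseteq> cube n" "distinct S" "n > 0" "m > 0" "length s = m"
    "\<And>p' h'. set p' \<subseteq> {..<n} \<Longrightarrow> length p' = k \<Longrightarrow> h' \<in> cube k \<rightarrow>\<^sub>E UNIV \<Longrightarrow>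
      m \<le> 3 * hdist (map (lift_junta p' h') S) s"
  shows "far_from_juntas n k (1 / 3) (dist_on S) (no_fun S s p h)"
  unfolding far_from_juntas_def
proof (intro allI impI)
  fix g assume "junta n k g"
  then obtain p' h' where g: "set p' \<subseteq> {..<n}" "length p' = k" "h' \<in> cube k \<rightarrow>\<^sub>E UNIV"
    "\<And>x. x \<in> cube n \<Longrightarrow> g x = lift_junta p' h' x"
    using junta_as_lift assms(4) by metis
  have "{i. i < length (map (lift_junta p' h') S) \<and> map (lift_junta p' h') S ! i \<noteq> s ! i} =
      {..<m} \<inter> {i. no_fun S s p h (S ! i) \<noteq> g (S ! i)}"
    using assms(1) no_fun_sample[OF assms(2,3,4)] g(4) subsetD[OF assms(2) nth_mem] by auto
  then have "m \<le> 3 * card ({..<m} \<inter> {i. no_fun S s p h (S ! i) \<noteq> g (S ! i)})"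
    using assms(7)[OF g(1-3)] by (simp add: hdist_def)
  then have "real m \<le> 3 * real (card ({..<m} \<inter> {i. no_fun S s p h (S ! i) \<noteq> g (S ! i)}))"
    by linarith
  then show "1 / 3 \<le> measure_pmf.prob (dist_on S) {x. no_fun S s p h x \<noteq> g x}"
    using assms(1,5) by (simp add: dist_on_def vimage_def measure_pmf_of_set lessThan_empty_iff field_simps)
qed

lemma prob_points_not_distinct:
  "measure_pmf.prob (points_pmf m n) {S. \<not> distinct S} \<le> real (m * m) * (1 / 2) ^ n"
proof -
  have single: "measure_pmf.prob (points_pmf m n) {S. fst z \<noteq> snd z \<and> S ! fst z = S ! snd z} \<le> (1 / 2) ^ n"
    if z: "z \<in> {..<m} \<times> {..<m}" for z
  proof (cases "fst z = snd z")
    case False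
    have "measure_pmf.prob (points_pmf m n) {S. S ! fst z = S ! snd z} \<le> (1 / 2) ^ n"
    proof (rule prob_replicate_pmf_entry[where g = "\<lambda>S. S ! fst z"])
      fix S :: "bool list list"
      have "{y. S ! fst z = y} = {S ! fst z}"
        by auto
      then show "measure_pmf.prob (replicate_pmf n coin) {y. S ! fst z = y} \<le> (1 / 2) ^ n"
        by (simp add: measure_pmf_single replicate_coin finite_cube cube_nonempty card_cube
            indicator_def power_one_over)
    qed (use z False in auto)
    then show ?thesis
      using False by simp
  qed simp
  have "measure_pmf.prob (points_pmf m n) {S. \<not> distinct S} \<le> measure_pmf.prob (points_pmf m n)
      {S. \<exists>z\<in>{..<m} \<times> {..<m}. fst z \<noteq> snd z \<and> S ! fst z = S ! snd z}"
  proof (rule prob_mono_pmf)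
    fix S assume "S \<in> set_pmf (points_pmf m n)" "\<not> distinct S"
    then show "\<exists>z\<in>{..<m} \<times> {..<m}. fst z \<noteq> snd z \<and> S ! fst z = S ! snd z"
      by (auto simp: set_points_pmf distinct_conv_nth)
  qed
  also have "\<dots> \<le> real (card ({..<m} \<times> {..<m})) * (1 / 2) ^ n"
    by (rule prob_union_bound) (use single in auto)
  finally show ?thesis
    by (simp add: card_cartesian_product)
qed

text \<open>For fixed \<open>S\<close>, each junta yields one label string, to which the random
  \<open>s\<close> is rarely close; a union bound runs over all pairs of coordinates and
  table.\<close>

lemma prob_instance_not_far:
  assumes "n > 0" "m > 0"
  shows "measure_pmf.prob (instance_pmf n m k)
      {(S, p, s, h). \<not> far_from_juntas n k (1 / 3) (dist_on S) (no_fun S s p h)}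
    \<le> real (m * m) * (1 / 2) ^ n + real (n ^ k * 2 ^ 2 ^ k) * (189 / 200) ^ m"
proof -
  let ?P = "instance_pmf n m k"
  define W where "W = {p. set p \<subseteq> {..<n} \<and> length p = k} \<times> (cube k \<rightarrow>\<^sub>E (UNIV :: bool set))"
  have W: "finite W" "card W = n ^ k * 2 ^ 2 ^ k"
    by (simp_all add: W_def finite_lists_length_eq finite_tables card_cartesian_product
        card_lists_length_eq card_PiE finite_cube card_cube)
  define close where
    "close S s \<longleftrightarrow> (\<exists>w\<in>W. 3 * hdist (map (lift_junta (fst w) (snd w)) S) s < 1 * m)" for S s
  have "measure_pmf.prob ?P {(S, p, s, h). \<not> far_from_juntas n k (1 / 3) (dist_on S) (no_fun S s p h)}
      \<le> measure_pmf.prob ?P {(S, p, s, h). \<not> distinct S \<or> close S s}"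
  proof (rule prob_mono_pmf)
    fix z assume z: "z \<in> set_pmf ?P"
      "case z of (S, p, s, h) \<Rightarrow> \<not> far_from_juntas n k (1 / 3) (dist_on S) (no_fun S s p h)"
    obtain S p s h where [simp]: "z = (S, p, s, h)"
      by (cases z) auto
    note S = set_instance_pmf[OF z(1)[simplified] assms(1)]
    have "far_from_juntas n k (1 / 3) (dist_on S) (no_fun S s p h)" if "distinct S" "\<not> close S s"
      using that S assms
      by (intro far_from_juntas_no_fun[of S m]) (fastforce simp: close_def W_def not_less)+
    then show "case z of (S, p, s, h) \<Rightarrow> \<not> distinct S \<or> close S s"
      using z(2) by auto
  qed
  also have "\<dots> \<le> measure_pmf.prob ?P {(S, p, s, h). \<not> distinct S} +
      measure_pmf.prob ?P {(S, p, s, h). close S s}"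
    unfolding split_def by (rule prob_disj_le)
  also have "\<dots> \<le> real (m * m) * (1 / 2) ^ n + real (n ^ k * 2 ^ 2 ^ k) * (189 / 200) ^ m"
  proof (rule add_mono)
    show "measure_pmf.prob ?P {(S, p, s, h). \<not> distinct S} \<le> real (m * m) * (1 / 2) ^ n"
      by (rule prob_instance_points[OF prob_points_not_distinct])
    show "measure_pmf.prob ?P {(S, p, s, h). close S s} \<le> real (n ^ k * 2 ^ 2 ^ k) * (189 / 200) ^ m"
    proof (rule prob_instance_labels)
      fix S :: "bool list list" assume "length S = m"
      then have "measure_pmf.prob (replicate_pmf m coin)
          {s. 3 * hdist (map (lift_junta (fst w) (snd w)) S) s < 1 * m} \<le> (189 / 200) ^ m" for w
        \<comment> \<open>4/5 approximates the optimal \<open>u\<close>, for which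
          \<open>u ^ 3 = 1 / 2\<close>; the resulting base is exactly 189/200.\<close>
        using hdist_tail[of "map (lift_junta (fst w) (snd w)) S" m "4 / 5" 3 1]
        by (simp add: power3_eq_cube)
      then show "measure_pmf.prob (replicate_pmf m coin) {s. close S s}
          \<le> real (n ^ k * 2 ^ 2 ^ k) * (189 / 200) ^ m"
        unfolding close_def W(2)[symmetric] by (intro prob_union_bound W(1))
    qed
  qed
  finally show ?thesis .
qed


section \<open>The lower bound\<close>

lemma two_powr_third: "(2 powr (real k / 3)) ^ 3 = 2 ^ k"
  by (simp add: powr_powr flip: powr_realpow)

text \<open>One factor \<open>(99 / 100) ^ n\<close> absorbs \<open>x * 2 ^ k\<close>, which is at
  most \<open>4 ^ k\<close>, because \<open>200 * k \<le> n\<close> and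
  \<open>(99 / 100) ^ 200 \<le> 1 / 4\<close>; the other absorbs the factor \<open>n\<close> of the
  number of points.\<close>

lemma error_bound:
  fixes k n N :: nat
  assumes "200 * k \<le> n" "real N < 2 powr (real k / 3) / 10 ^ 6"
  shows "2 * (real (N * (39 * n * 2 ^ k)) * (99 / 100) ^ (2 * n)) + 2 * (real (N * N) * (3 / 5) ^ k) \<le> 1 / 12"
proof -
  define x :: real where "x = 2 powr (real k / 3)"
  have x3: "x ^ 3 = 2 ^ k"
    by (simp add: x_def two_powr_third)
  have x1: "x \<ge> 1"
    by (simp add: x_def ge_one_powr_ge_zero)
  have N: "real N \<le> x / 10 ^ 6"
    using assms(2) by (simp add: x_def)
  have "x ^ 1 \<le> x ^ 3"
    using x1 by (intro power_increasing) auto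
  then have x2k: "x \<le> 2 ^ k"
    using x3 by simp
  have "(99 / 100 :: real) ^ n \<le> (99 / 100) ^ (200 * k)"
    using assms(1) by (intro power_decreasing) auto
  also have "\<dots> = ((99 / 100) ^ 200) ^ k"
    by (simp only: power_mult)
  also have "\<dots> \<le> (1 / 4) ^ k"
    by (intro power_mono) (simp_all add: field_simps)
  finally have "x * 2 ^ k * (99 / 100) ^ n \<le> 2 ^ k * 2 ^ k * (1 / 4) ^ k"
    using x1 x2k by (intro mult_mono) auto
  also have "\<dots> = 1"
    by (simp flip: power_mult_distrib)
  finally have a: "x * 2 ^ k * (99 / 100) ^ n \<le> 1" .
  \<comment> \<open>Bernoulli's inequality applies to the reciprocal of 99/100, which is
    \<open>1 + 1 / 99\<close>.\<close>
  have "1 + real n * (1 / 99) \<le> (1 + 1 / 99) ^ n"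
    by (rule Bernoulli_inequality) simp
  also have "(1 + 1 / 99 :: real) ^ n = 1 / (99 / 100) ^ n"
    by (simp add: power_divide)
  finally have "(99 / 100) ^ n + real n * (99 / 100) ^ n / 99 \<le> 1"
    by (simp add: pos_le_divide_eq distrib_right)
  moreover have "(99 / 100 :: real) ^ n \<ge> 0"
    by simp
  ultimately have b: "real n * (99 / 100) ^ n \<le> 100"
    by linarith
  have "real (N * (39 * n * 2 ^ k)) * (99 / 100) ^ (2 * n) =
      39 * real N * 2 ^ k * (99 / 100) ^ n * (real n * (99 / 100) ^ n)"
    by (simp add: mult_2 power_add)
  also have "\<dots> \<le> 39 * (x / 10 ^ 6) * 2 ^ k * (99 / 100) ^ n * 100"
    using x1 N b by (intro mult_mono) auto
  also have "\<dots> = 39 / 10 ^ 4 * (x * 2 ^ k * (99 / 100) ^ n)"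
    by simp
  also have "\<dots> \<le> 39 / 10 ^ 4 * 1"
    using a by (intro mult_left_mono) auto
  finally have first: "real (N * (39 * n * 2 ^ k)) * (99 / 100) ^ (2 * n) \<le> 39 / 10 ^ 4"
    by simp
  \<comment> \<open>Cubing removes the third root in \<open>x\<close> and leaves a power of
    \<open>4 * 27 / 125\<close>, which is below 1.\<close>
  have "(x\<^sup>2 * (3 / 5) ^ k) ^ 3 = (x ^ 3)\<^sup>2 * ((3 / 5) ^ 3) ^ k"
    by (simp add: power_mult_distrib flip: power_mult) (simp add: mult.commute)
  also have "\<dots> = (2\<^sup>2 * (3 / 5) ^ 3) ^ k"
    unfolding x3 power_mult_distrib by (simp only: power_mult[symmetric] mult.commute[of k])
  also have "\<dots> \<le> 1 ^ 3"
    by (simp add: power_le_one power3_eq_cube)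
  finally have c: "x\<^sup>2 * (3 / 5) ^ k \<le> 1"
    using power_le_imp_le_base[of "x\<^sup>2 * (3 / 5) ^ k" 2 1] by (simp add: eval_nat_numeral)
  have "real (N * N) * (3 / 5) ^ k \<le> (x / 10 ^ 6 * (x / 10 ^ 6)) * (3 / 5) ^ k"
    unfolding of_nat_mult using N x1 by (intro mult_mono) auto
  also have "\<dots> = x\<^sup>2 * (3 / 5) ^ k / 10 ^ 12"
    by (simp add: power2_eq_square)
  also have "\<dots> \<le> 1 / 10 ^ 12"
    using c by simp
  finally have "real (N * N) * (3 / 5) ^ k \<le> 1 / 10 ^ 12" .
  with first show ?thesis
    by simp
qed

text \<open>The constant is \<open>24 * 39\<^sup>2 * 4\<close>, as it arises in
  \<open>not_far_bound\<close>.\<close>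

lemma square_le_two_power: "100 \<le> r \<Longrightarrow> 146016 * r\<^sup>2 \<le> (2 :: nat) ^ r"
proof (induction r rule: nat_induct_at_least)
  case (Suc r)
  have "100 * r \<le> r * r"
    using Suc.hyps by (intro mult_right_mono) auto
  moreover have "(Suc r)\<^sup>2 = r * r + 2 * r + 1" "r\<^sup>2 = r * r"
    by (simp_all add: power2_eq_square)
  ultimately have "(Suc r)\<^sup>2 \<le> 2 * r\<^sup>2"
    using Suc.hyps by linarith
  then show ?case
    using Suc.IH by simp
qed simp

lemma not_far_bound:
  fixes k n :: nat
  assumes "200 * k \<le> n" "k > 0"
  shows "real (39 * n * 2 ^ k * (39 * n * 2 ^ k)) * (1 / 2) ^ n +
    real (n ^ k * 2 ^ 2 ^ k) * (189 / 200) ^ (39 * n * 2 ^ k) \<le> 1 / 12"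
proof -
  \<comment> \<open>Setting \<open>2 * k\<close> aside cancels the factor \<open>4 ^ k\<close> of
    the squared number of points; \<open>n \<le> 2 * r\<close> costs only a factor 4.\<close>
  define r where "r = n - 2 * k"
  have r: "n = r + 2 * k" "n \<le> 2 * r" "100 \<le> r"
    using assms by (auto simp: r_def)
  have "24 * (39 * n * 2 ^ k * (39 * n * 2 ^ k)) = 36504 * n\<^sup>2 * 4 ^ k"
    by (simp add: power2_eq_square flip: power_mult_distrib)
  also have "\<dots> \<le> 36504 * (2 * r)\<^sup>2 * 4 ^ k"
    using r(2) by (intro mult_mono power_mono) auto
  also have "\<dots> = 146016 * r\<^sup>2 * 4 ^ k"
    by (simp add: power2_eq_square)
  also have "\<dots> \<le> 2 ^ r * 4 ^ k"
    using square_le_two_power[OF r(3)] by simp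
  also have "\<dots> = 2 ^ n"
    by (simp add: r(1) power_add power_mult)
  finally have "real (24 * (39 * n * 2 ^ k * (39 * n * 2 ^ k))) \<le> real (2 ^ n)"
    by (simp only: of_nat_le_iff)
  then have first: "real (39 * n * 2 ^ k * (39 * n * 2 ^ k)) * (1 / 2) ^ n \<le> 1 / 24"
    by (simp add: power_one_over field_simps)
  define M where "M = n * 2 ^ k"
  have n1: "1 \<le> n"
    using assms by simp
  have "n ^ k \<le> (2 ^ n) ^ k"
    by (intro power_mono) (auto intro: less_imp_le)
  also have "\<dots> = 2 ^ (n * k)"
    by (simp add: power_mult)
  also have "\<dots> \<le> 2 ^ M"
    unfolding M_def by (intro power_increasing mult_left_mono) (auto intro: less_imp_le)
  finally have "n ^ k * 2 ^ 2 ^ k \<le> 2 ^ M * 2 ^ M"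
    unfolding M_def using n1 by (intro mult_mono power_increasing) auto
  then have "real (n ^ k * 2 ^ 2 ^ k) \<le> real (2 ^ M * 2 ^ M)"
    by (simp only: of_nat_le_iff)
  also have "\<dots> = 4 ^ M"
    by (simp flip: power_mult_distrib)
  finally have c: "real (n ^ k * 2 ^ 2 ^ k) \<le> 4 ^ M" .
  \<comment> \<open>39 sample points per unit of \<open>M\<close> push the Chernoff factor down to
    \<open>(1 / 8) ^ M\<close>, against at most \<open>4 ^ M\<close> juntas.\<close>
  have "(189 / 200 :: real) ^ (39 * n * 2 ^ k) = ((189 / 200) ^ 39) ^ M"
    by (simp only: M_def power_mult mult.assoc)
  also have "\<dots> \<le> (1 / 8) ^ M"
    by (intro power_mono) (simp_all add: field_simps)
  finally have "real (n ^ k * 2 ^ 2 ^ k) * (189 / 200) ^ (39 * n * 2 ^ k) \<le> 4 ^ M * (1 / 8) ^ M"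
    using c by (intro mult_mono) auto
  also have "\<dots> = (1 / 2) ^ M"
    by (simp flip: power_mult_distrib)
  also have "\<dots> \<le> (1 / 2) ^ 5"
  proof (rule power_decreasing)
    have "n * 1 \<le> M"
      unfolding M_def by (intro mult_left_mono) auto
    then show "5 \<le> M"
      using assms by linarith
  qed auto
  also have "\<dots> \<le> (1 / 24 :: real)"
    by (simp add: power_divide)
  finally show ?thesis
    using first by linarith
qed

theorem theorem2:
  "\<exists>c::real. c > 0 \<and>
     (\<forall>(k::nat) (n::nat) (T :: algorithm pmf).
        k > 0 \<longrightarrow> n > 0 \<longrightarrow> real k \<le> real n / 200 \<longrightarrow>
        nonadaptive_junta_tester n k (1 / 3) T \<longrightarrow>
        ereal (c * 2 powr (real k / 3)) \<le> ereal_of_enat (query_complexity n T))"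
proof (intro exI[of _ "1 / 10 ^ 6"] conjI allI impI)
  fix k n :: nat and T :: "algorithm pmf"
  assume k: "k > 0" and n: "n > 0" and "real k \<le> real n / 200"
    and T: "nonadaptive_junta_tester n k (1 / 3) T"
  then have kn: "200 * k \<le> n"
    by linarith
  show "ereal (1 / 10 ^ 6 * 2 powr (real k / 3)) \<le> ereal_of_enat (query_complexity n T)"
  proof (rule ccontr)
    assume "\<not> ereal (1 / 10 ^ 6 * 2 powr (real k / 3)) \<le> ereal_of_enat (query_complexity n T)"
    \<comment> \<open>An infinite query complexity satisfies the bound, so a counterexample has a
      finite budget \<open>N\<close>.\<close>
    then obtain N where N: "query_complexity n T = enat N" "real N < 2 powr (real k / 3) / 10 ^ 6"
      by (cases "query_complexity n T") auto
    have cost: "cost n f A \<le> N" if "A \<in> set_pmf T" for f A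
    proof -
      have "enat (cost n f A) \<le> query_complexity n T"
        unfolding query_complexity_def by (intro SUP_upper2[OF that] SUP_upper) simp
      then show ?thesis
        by (simp add: N(1))
    qed
    define m where "m = 39 * n * 2 ^ k"
    have m: "m > 0"
      using n by (simp add: m_def)
    let ?P = "instance_pmf n m k"
    let ?yes = "bind_pmf ?P (\<lambda>(S, p, s, h). randomized_verdict T (lift_junta p h) (dist_on S))"
    let ?no = "bind_pmf ?P (\<lambda>(S, p, s, h). randomized_verdict T (no_fun S s p h) (dist_on S))"
    have cube: "set_pmf (dist_on S) \<subseteq> cube n" if "(S, p, s, h) \<in> set_pmf ?P" for S p s h
      using set_instance_pmf[OF that n] subsetD[of "set S" "cube n", OF _ nth_mem] m
      by (auto simp: dist_on_def lessThan_empty_iff)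
    \<comment> \<open>As in Yao's principle, averaging over \<open>T\<close> outermost reduces the
      comparison to deterministic algorithms.\<close>
    have swap: "bind_pmf ?P (\<lambda>(S, p, s, h). randomized_verdict T (F S p s h) (dist_on S)) =
        bind_pmf T (\<lambda>A. bind_pmf ?P (\<lambda>(S, p, s, h). verdict (F S p s h) (dist_on S) A))" for F
      unfolding randomized_verdict_def split_def by (rule bind_commute_pmf)
    have "2 / 3 \<le> pmf ?yes True"
    proof (rule pmf_bind_ge)
      fix z assume z: "z \<in> set_pmf ?P"
      obtain S p s h where [simp]: "z = (S, p, s, h)"
        by (cases z) auto
      show "2 / 3 \<le> pmf (case z of (S, p, s, h) \<Rightarrow> randomized_verdict T (lift_junta p h) (dist_on S)) True"
        using T cube[OF z[simplified]] junta_lift_junta[OF set_instance_pmf(3)[OF z[simplified] n]]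
        by (simp add: nonadaptive_junta_tester_def)
    qed
    also have "pmf ?yes True \<le> pmf ?no True + 1 / 12"
      unfolding swap
    proof (rule pmf_bind_mono)
      fix A assume A: "A \<in> set_pmf T"
      then have "queries_in_cube n A"
        using T by (simp add: nonadaptive_junta_tester_def)
      from yes_no_difference[OF n m this cost[OF A], of k] error_bound[OF kn N(2)]
      show "pmf (bind_pmf ?P (\<lambda>(S, p, s, h). verdict (lift_junta p h) (dist_on S) A)) True
          \<le> pmf (bind_pmf ?P (\<lambda>(S, p, s, h). verdict (no_fun S s p h) (dist_on S) A)) True + 1 / 12"
        unfolding m_def by linarith
    qed
    also have "pmf ?no True \<le> 1 / 3 + measure_pmf.prob ?P
        {(S, p, s, h). \<not> far_from_juntas n k (1 / 3) (dist_on S) (no_fun S s p h)}"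
    proof (rule pmf_bind_le_bad)
      fix z assume z: "z \<in> set_pmf ?P"
        "z \<notin> {(S, p, s, h). \<not> far_from_juntas n k (1 / 3) (dist_on S) (no_fun S s p h)}"
      obtain S p s h where [simp]: "z = (S, p, s, h)"
        by (cases z) auto
      have "2 / 3 \<le> pmf (randomized_verdict T (no_fun S s p h) (dist_on S)) False"
        using T cube[OF z(1)[simplified]] z(2) by (simp add: nonadaptive_junta_tester_def)
      then show "pmf (case z of (S, p, s, h) \<Rightarrow> randomized_verdict T (no_fun S s p h) (dist_on S)) True
          \<le> 1 / 3"
        by (simp add: pmf_False_conv_True)
    qed simp
    \<comment> \<open>The no-side accepts with probability at most 1/3 + 1/12, so 2/3 would be at
      most 1/3 + 1/12 + 1/12 = 1/2.\<close>
    finally show False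
      using prob_instance_not_far[OF n m, of k] not_far_bound[OF kn k] unfolding m_def by linarith
  qed
qed simp

end
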